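(* (1) A reduced LEO triple $(C,D,f)$ is trivial in $\widetilde{\mathcal{C}}_{LEO}$ if and only if $\tilde s_c(C,D,f)=\tilde s_c(C^*,D^*,f^* )=0$. (2) Similarly, a two-reduced LEO triple $(C,D,f)$ is trivial in $\widetilde{\mathcal{C}}^{\,o}_{LEO}$ if and only if $\tilde s_o(C,D,f)=\tilde s_o(C^*,D^*,f^* )=0$.
   Context: Conventions. All complexes are bigraded cochain complexes ($i$ homological, $q$ quantum grading) with differential of bidegree $(1,0)$; "finitely generated free" means free on finitely many homogeneous generators. $\mathbb{F}_2=\mathbb{Z}/2$; $h$ has bidegree $(0,-2)$; $h^{-1}D$ is $D$ with $h$ inverted; $D_{h=0}=D/hD$. $H^{i,q}(M)$ is cohomology in bigrading $(i,q)$, $H^{i,q}(M;A)=H^{i,q}(M\otimes_{\mathbb{Z}}A)$. A reduced LEO triple $(C,D,f)$ consists of finitely generated free bigraded complexes $C$ over $\mathbb{Z}$ and $D$ over $S=\mathbb{Z}[h]$, and a bigraded homotopy equivalence $f\colon C\otimes_{\mathbb{Z}}\mathbb{Z}/(2)\to D\otimes_{S}S/(2,h)$, such that $h^{-1}D$ is homotopy equivalent to a free graded module of rank 1 over $h^{-1}S=S[h^{-1}]$, supported in homological grading $0$ and even quantum gradings. A two-reduced LEO triple is defined identically with $S=\mathbb{F}_2[h]$ in place of $\mathbb{Z}[h]$. In either case a local map $(C,D,f)\to(C',D',f')$ is a pair of bigrading-preserving chain maps $\alpha\colon C\to C'$ over $\mathbb{Z}$, $\beta\colon D\to D'$ over $S$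 such that $\beta\colon h^{-1}D\to h^{-1}D'$ is a homotopy equivalence and $f'\circ\alpha$ and $\beta\circ f$ are chain homotopic as maps $C\otimes\mathbb{F}_2\to D'\otimes_SS/(2,h)$. Two triples are locally equivalent if there are local maps in both directions. $\widetilde{\mathcal{C}}_{LEO}$ (for $S=\mathbb{Z}[h]$) and $\widetilde{\mathcal{C}}^{\,o}_{LEO}$ (for $S=\mathbb{F}_2[h]$) are the abelian groups of local equivalence classes, with addition $(C\otimes_{\mathbb{Z}}C',D\otimes_{S}D',f\otimes f')$, identity the class of $(\mathbb{Z},S,\mathrm{id})$ (generators in bigrading $(0,0)$), and inverse the class of the dual $(C^*,D^*,f^* )=(\mathrm{Hom}_{\mathbb{Z}}(C,\mathbb{Z}),\mathrm{Hom}_{S}(D,S),\overline f)$, with gradings negated on dual generators and $\overline f$ the transpose of a homotopy inverse of $f$. "Trivial" means equal to the identity. Invariants. Let $j\colon H^{0,q}(C)\to H^{0,q}(C;\mathbb{F}_2)$, let $p$ be reduction to $H^{0,q}(D_{h=0};\mathbb{F}_2)$, and $i$ the localization map. For a reduced LEO triple, an even $q$ is completely reduced-full if there exist $\check a\in H^{0,q}(C)$ and $a\in H^{0,q}(D)$ with $f(j(\check a))=p(a)$ in $H^{0,q}(D_{h=0};\mathbb{F}_2)$ and $i(a)$ a generator of $H^{0,q}(h^{-1}D)\cong\mathbb{Z}$ as a $\mathbb{Z}$-module; $\tilde s_c(C,D,f)=\max\{q\in2\mathbb{Z}\mid q\text{ is completely reduced-full}\}$. For a two-reduced LEO triple, an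 even $q$ is oddly reduced-full if there exist $\check a\in H^{0,q}(C)$ and $a\in H^{0,q}(D)$ with $f(j(\check a))=p(a)$ in $H^{0,q}(D_{h=0})$ and $i(a)\ne0$ in $H^{0,q}(h^{-1}D)$; $\tilde s_o(C,D,f)=\max\{q\in2\mathbb{Z}\mid q\text{ is oddly reduced-full}\}$. *)

theory Defs
  imports
    "HOL-Library.Z2"
    "HOL-Library.Poly_Mapping"
    "HOL-Computational_Algebra.Polynomial"
    "HOL-Algebra.Coset"
    "HOL-Algebra.Generated_Groups"
    "Jordan_Normal_Form.Matrix"
begin

section \<open>Graded coefficient rings\<close>

text \<open>
  The quantum grading of a coefficient ring is given by the function sending an integer \<open>k\<close> to
  the set of homogeneous elements of degree \<open>k\<close> (including 0).  A ground ring is concentrated in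
  degree 0, and \<open>h\<close> has degree \<open>-2\<close>.  The polynomial ring in \<open>h\<close> over \<open>'k\<close> is \<open>'k poly\<close>; its
  localization at \<open>h\<close> is the Laurent polynomial ring, rendered as the group algebra
  \<open>int \<Rightarrow>\<^sub>0 'k\<close> of the integers.
\<close>

type_synonym 'r grading = "int \<Rightarrow> 'r set"

definition ground_gr :: "'k::zero grading" where
  "ground_gr k = (if k = 0 then UNIV else {0})"

definition poly_gr :: "'k::zero poly grading" where
  "poly_gr k = {p. \<forall>n. Polynomial.coeff p n \<noteq> 0 \<longrightarrow> k = - 2 * int n}"

type_synonym 'k laurent = "int \<Rightarrow>\<^sub>0 'k"

definition laurent_gr :: "'k::zero laurent grading" where
  "laurent_gr k = {p. \<forall>n \<in> Poly_Mapping.keys p. k = - 2 * n}"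

definition to_laurent :: "'k::comm_ring_1 poly \<Rightarrow> 'k laurent" where
  "to_laurent p = (\<Sum>n\<le>degree p. Poly_Mapping.single (int n) (Polynomial.coeff p n))"


section \<open>Finitely generated free bigraded complexes\<close>

text \<open>
  A complex is given by the list of bidegrees (homological, quantum) of its homogeneous
  generators and the matrix of its differential; the entry in row \<open>i\<close> and column \<open>j\<close> of a matrix
  is the coefficient of the \<open>i\<close>-th target generator in the image of the \<open>j\<close>-th source generator.
\<close>

record 'r cplx =
  gens :: "(int \<times> int) list"
  diff :: "'r mat"

abbreviation rank :: "'r cplx \<Rightarrow> nat" where
  "rank X \<equiv> length (gens X)"

abbreviation hdeg :: "'r cplx \<Rightarrow> nat \<Rightarrow> int" where
  "hdeg X i \<equiv> fst (gens X ! i)"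

abbreviation qdeg :: "'r cplx \<Rightarrow> nat \<Rightarrow> int" where
  "qdeg X i \<equiv> snd (gens X ! i)"

definition hom_map ::
  "'r::comm_ring_1 grading \<Rightarrow> int \<times> int \<Rightarrow> 'r cplx \<Rightarrow> 'r cplx \<Rightarrow> 'r mat \<Rightarrow> bool" where
  "hom_map G ab X Y M \<longleftrightarrow> M \<in> carrier_mat (rank Y) (rank X) \<and>
     (\<forall>i < rank Y. \<forall>j < rank X.
        M $$ (i, j) \<in> (if hdeg Y i = hdeg X j + fst ab
                       then G (qdeg X j + snd ab - qdeg Y i) else {0}))"

definition is_cplx :: "'r::comm_ring_1 grading \<Rightarrow> 'r cplx \<Rightarrow> bool" where
  "is_cplx G X \<longleftrightarrow> hom_map G (1, 0) X X (diff X) \<and> diff X * diff X = 0\<^sub>m (rank X) (rank X)"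

definition chain_map :: "'r::comm_ring_1 grading \<Rightarrow> 'r cplx \<Rightarrow> 'r cplx \<Rightarrow> 'r mat \<Rightarrow> bool" where
  "chain_map G X Y M \<longleftrightarrow> hom_map G (0, 0) X Y M \<and> diff Y * M = M * diff X"

definition homotopic ::
  "'r::comm_ring_1 grading \<Rightarrow> 'r cplx \<Rightarrow> 'r cplx \<Rightarrow> 'r mat \<Rightarrow> 'r mat \<Rightarrow> bool" where
  "homotopic G X Y M N \<longleftrightarrow>
     (\<exists>K. hom_map G (-1, 0) X Y K \<and> M - N = diff Y * K + K * diff X)"

definition homotopy_inverse ::
  "'r::comm_ring_1 grading \<Rightarrow> 'r cplx \<Rightarrow> 'r cplx \<Rightarrow> 'r mat \<Rightarrow> 'r mat \<Rightarrow> bool" where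
  "homotopy_inverse G X Y f g \<longleftrightarrow> chain_map G Y X g \<and>
     homotopic G X X (g * f) (1\<^sub>m (rank X)) \<and> homotopic G Y Y (f * g) (1\<^sub>m (rank Y))"

definition homotopy_equiv ::
  "'r::comm_ring_1 grading \<Rightarrow> 'r cplx \<Rightarrow> 'r cplx \<Rightarrow> 'r mat \<Rightarrow> bool" where
  "homotopy_equiv G X Y f \<longleftrightarrow> chain_map G X Y f \<and> (\<exists>g. homotopy_inverse G X Y f g)"

definition base_change :: "('r \<Rightarrow> 's) \<Rightarrow> 'r cplx \<Rightarrow> 's cplx" where
  "base_change \<phi> X = \<lparr>gens = gens X, diff = map_mat \<phi> (diff X)\<rparr>"

text \<open>The free module of rank 1 generated in a given bidegree, with zero differential.\<close>

definition rank_one :: "int \<times> int \<Rightarrow> 'r::zero cplx" where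
  "rank_one ab = \<lparr>gens = [ab], diff = 0\<^sub>m 1 1\<rparr>"

definition dual_cplx :: "'r cplx \<Rightarrow> 'r cplx" where
  "dual_cplx X = \<lparr>gens = map (\<lambda>(a, b). (- a, - b)) (gens X), diff = transpose_mat (diff X)\<rparr>"

text \<open>
  In a tensor product, the pair of the \<open>i\<close>-th and the \<open>j\<close>-th generator has index \<open>i * n + j\<close>,
  where \<open>n\<close> is the rank of the second factor.  The differential is
  \<open>d(x \<otimes> y) = dx \<otimes> y + (-1)^|x| x \<otimes> dy\<close>.
\<close>

definition kronecker :: "'r::comm_ring_1 mat \<Rightarrow> 'r mat \<Rightarrow> 'r mat" where
  "kronecker A B = mat (dim_row A * dim_row B) (dim_col A * dim_col B)
     (\<lambda>(i, j). A $$ (i div dim_row B, j div dim_col B) * B $$ (i mod dim_row B, j mod dim_col B))"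

definition sign_mat :: "'r::comm_ring_1 cplx \<Rightarrow> 'r mat" where
  "sign_mat X = mat (rank X) (rank X)
     (\<lambda>(i, j). if i = j then (if even (hdeg X i) then 1 else - 1) else 0)"

definition tensor_cplx :: "'r::comm_ring_1 cplx \<Rightarrow> 'r cplx \<Rightarrow> 'r cplx" where
  "tensor_cplx X Y =
     \<lparr>gens = map (\<lambda>((a, b), (a', b')). (a + a', b + b')) (List.product (gens X) (gens Y)),
      diff = kronecker (diff X) (1\<^sub>m (rank Y)) + kronecker (sign_mat X) (diff Y)\<rparr>"


section \<open>Cohomology\<close>

definition cochains ::
  "'r::comm_ring_1 grading \<Rightarrow> 'r cplx \<Rightarrow> int \<Rightarrow> int \<Rightarrow> 'r vec set" where
  "cochains G X i q = {v \<in> carrier_vec (rank X).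
     \<forall>j < rank X. v $ j \<in> (if hdeg X j = i then G (q - qdeg X j) else {0})}"

definition cocycles ::
  "'r::comm_ring_1 grading \<Rightarrow> 'r cplx \<Rightarrow> int \<Rightarrow> int \<Rightarrow> 'r vec set" where
  "cocycles G X i q = {v \<in> cochains G X i q. diff X *\<^sub>v v = 0\<^sub>v (rank X)}"

definition coboundaries ::
  "'r::comm_ring_1 grading \<Rightarrow> 'r cplx \<Rightarrow> int \<Rightarrow> int \<Rightarrow> 'r vec set" where
  "coboundaries G X i q = (\<lambda>w. diff X *\<^sub>v w) ` cochains G X (i - 1) q"

definition cohomology ::
  "'r::comm_ring_1 grading \<Rightarrow> 'r cplx \<Rightarrow> int \<Rightarrow> int \<Rightarrow> 'r vec set monoid" where
  "cohomology G X i q =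
     (monoid_vec TYPE('r) (rank X))\<lparr>carrier := cocycles G X i q\<rparr> Mod coboundaries G X i q"

text \<open>
  The map on cohomology induced by a map \<open>\<phi>\<close> of cochains with target \<open>Y\<close>, which need not be
  linear over a fixed ring, so that reductions and localization are covered: the coset of \<open>x\<close> is
  sent to the coset of \<open>\<phi> x\<close>.
\<close>

definition coh_map ::
  "'s::comm_ring_1 grading \<Rightarrow> 's cplx \<Rightarrow> int \<Rightarrow> int \<Rightarrow> ('r vec \<Rightarrow> 's vec) \<Rightarrow> 'r vec set \<Rightarrow> 's vec set"
  where
  "coh_map G Y i q \<phi> A = coboundaries G Y i q <#>\<^bsub>monoid_vec TYPE('s) (rank Y)\<^esub> (\<phi> ` A)"


section \<open>LEO triples\<close>

text \<open>
  Reduced and two-reduced triples are treated uniformly: \<open>D\<close> is a complex over \<open>S = 'k poly\<close>, and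
  \<open>r :: 'k \<Rightarrow> bit\<close> is the reduction of the ground ring modulo 2 (\<open>of_int\<close> for the integers, \<open>id\<close> for
  the field with two elements), so that \<open>red_S r\<close> is the quotient map from \<open>S\<close> to \<open>S/(2,h)\<close>.
\<close>

record (overloaded) ('k::zero) leo =
  Cpart :: "int cplx"
  Dpart :: "'k poly cplx"
  fpart :: "bit mat"

definition red_S :: "('k::comm_ring_1 \<Rightarrow> bit) \<Rightarrow> 'k poly \<Rightarrow> bit" where
  "red_S r p = r (poly p 0)"

definition C_mod :: "'k::zero leo \<Rightarrow> bit cplx" where
  "C_mod T = base_change of_int (Cpart T)"

definition D_mod :: "('k::comm_ring_1 \<Rightarrow> bit) \<Rightarrow> 'k leo \<Rightarrow> bit cplx" where
  "D_mod r T = base_change (red_S r) (Dpart T)"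

definition D_loc :: "'k::comm_ring_1 leo \<Rightarrow> 'k laurent cplx" where
  "D_loc T = base_change to_laurent (Dpart T)"

definition leo_triple :: "('k::comm_ring_1 \<Rightarrow> bit) \<Rightarrow> 'k leo \<Rightarrow> bool" where
  "leo_triple r T \<longleftrightarrow>
     is_cplx ground_gr (Cpart T) \<and> is_cplx poly_gr (Dpart T) \<and>
     homotopy_equiv ground_gr (C_mod T) (D_mod r T) (fpart T) \<and>
     (\<exists>q g. even q \<and> homotopy_equiv laurent_gr (D_loc T) (rank_one (0, q)) g)"

definition local_map ::
  "('k::comm_ring_1 \<Rightarrow> bit) \<Rightarrow> 'k leo \<Rightarrow> 'k leo \<Rightarrow> int mat \<Rightarrow> 'k poly mat \<Rightarrow> bool" where
  "local_map r T T' \<alpha> \<beta> \<longleftrightarrow>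
     chain_map ground_gr (Cpart T) (Cpart T') \<alpha> \<and>
     chain_map poly_gr (Dpart T) (Dpart T') \<beta> \<and>
     homotopy_equiv laurent_gr (D_loc T) (D_loc T') (map_mat to_laurent \<beta>) \<and>
     homotopic ground_gr (C_mod T) (D_mod r T')
       (fpart T' * map_mat of_int \<alpha>) (map_mat (red_S r) \<beta> * fpart T)"

definition local_equiv :: "('k::comm_ring_1 \<Rightarrow> bit) \<Rightarrow> ('k leo \<times> 'k leo) set" where
  "local_equiv r = {(T, T'). leo_triple r T \<and> leo_triple r T' \<and>
     (\<exists>\<alpha> \<beta>. local_map r T T' \<alpha> \<beta>) \<and> (\<exists>\<alpha> \<beta>. local_map r T' T \<alpha> \<beta>)}"

definition unit_triple :: "'k::comm_ring_1 leo" where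
  "unit_triple = \<lparr>Cpart = rank_one (0, 0), Dpart = rank_one (0, 0), fpart = 1\<^sub>m 1\<rparr>"

definition tensor_triple :: "'k::comm_ring_1 leo \<Rightarrow> 'k leo \<Rightarrow> 'k leo" where
  "tensor_triple T T' =
     \<lparr>Cpart = tensor_cplx (Cpart T) (Cpart T'), Dpart = tensor_cplx (Dpart T) (Dpart T'),
      fpart = kronecker (fpart T) (fpart T')\<rparr>"

text \<open>The dual triple depends on the choice of a homotopy inverse \<open>g\<close> of the map \<open>f\<close>.\<close>

definition dual_triple :: "'k::zero leo \<Rightarrow> bit mat \<Rightarrow> 'k leo" where
  "dual_triple T g =
     \<lparr>Cpart = dual_cplx (Cpart T), Dpart = dual_cplx (Dpart T), fpart = transpose_mat g\<rparr>"

definition leo_homotopy_inverse :: "('k::comm_ring_1 \<Rightarrow> bit) \<Rightarrow> 'k leo \<Rightarrow> bit mat \<Rightarrow> bool" where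
  "leo_homotopy_inverse r T g \<longleftrightarrow> homotopy_inverse ground_gr (C_mod T) (D_mod r T) (fpart T) g"

definition leo_group :: "('k::comm_ring_1 \<Rightarrow> bit) \<Rightarrow> 'k leo set monoid" where
  "leo_group r =
     \<lparr>carrier = {T. leo_triple r T} // local_equiv r,
      mult = (\<lambda>A B. \<Union>T\<in>A. \<Union>T'\<in>B. local_equiv r `` {tensor_triple T T'}),
      one = local_equiv r `` {unit_triple}\<rparr>"

definition trivial_triple :: "('k::comm_ring_1 \<Rightarrow> bit) \<Rightarrow> 'k leo \<Rightarrow> bool" where
  "trivial_triple r T \<longleftrightarrow> local_equiv r `` {T} = \<one>\<^bsub>leo_group r\<^esub>"

abbreviation mod2_int :: "int \<Rightarrow> bit" where "mod2_int \<equiv> of_int"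

abbreviation mod2_bit :: "bit \<Rightarrow> bit" where "mod2_bit \<equiv> id"


section \<open>The invariants\<close>

definition coh_C :: "'k::zero leo \<Rightarrow> int \<Rightarrow> int vec set monoid" where
  "coh_C T q = cohomology ground_gr (Cpart T) 0 q"

definition coh_D :: "'k::comm_ring_1 leo \<Rightarrow> int \<Rightarrow> 'k poly vec set monoid" where
  "coh_D T q = cohomology poly_gr (Dpart T) 0 q"

definition coh_D_loc :: "'k::comm_ring_1 leo \<Rightarrow> int \<Rightarrow> 'k laurent vec set monoid" where
  "coh_D_loc T q = cohomology laurent_gr (D_loc T) 0 q"

definition j_map :: "'k::zero leo \<Rightarrow> int \<Rightarrow> int vec set \<Rightarrow> bit vec set" where
  "j_map T q = coh_map ground_gr (C_mod T) 0 q (map_vec of_int)"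

definition f_map :: "('k::comm_ring_1 \<Rightarrow> bit) \<Rightarrow> 'k leo \<Rightarrow> int \<Rightarrow> bit vec set \<Rightarrow> bit vec set" where
  "f_map r T q = coh_map ground_gr (D_mod r T) 0 q (\<lambda>v. fpart T *\<^sub>v v)"

definition p_map :: "('k::comm_ring_1 \<Rightarrow> bit) \<Rightarrow> 'k leo \<Rightarrow> int \<Rightarrow> 'k poly vec set \<Rightarrow> bit vec set" where
  "p_map r T q = coh_map ground_gr (D_mod r T) 0 q (map_vec (red_S r))"

definition i_map :: "'k::comm_ring_1 leo \<Rightarrow> int \<Rightarrow> 'k poly vec set \<Rightarrow> 'k laurent vec set" where
  "i_map T q = coh_map laurent_gr (D_loc T) 0 q (map_vec to_laurent)"

definition completely_reduced_full :: "int leo \<Rightarrow> int \<Rightarrow> bool" where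
  "completely_reduced_full T q \<longleftrightarrow> even q \<and>
     (\<exists>c \<in> carrier (coh_C T q). \<exists>a \<in> carrier (coh_D T q).
        f_map mod2_int T q (j_map T q c) = p_map mod2_int T q a \<and>
        generate (coh_D_loc T q) {i_map T q a} = carrier (coh_D_loc T q))"

definition oddly_reduced_full :: "bit leo \<Rightarrow> int \<Rightarrow> bool" where
  "oddly_reduced_full T q \<longleftrightarrow> even q \<and>
     (\<exists>c \<in> carrier (coh_C T q). \<exists>a \<in> carrier (coh_D T q).
        f_map mod2_bit T q (j_map T q c) = p_map mod2_bit T q a \<and>
        i_map T q a \<noteq> \<one>\<^bsub>coh_D_loc T q\<^esub>)"

definition s_c :: "int leo \<Rightarrow> int" where
  "s_c T = (GREATEST q. completely_reduced_full T q)"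

definition s_o :: "bit leo \<Rightarrow> int" where
  "s_o T = (GREATEST q. oddly_reduced_full T q)"

end

theory Submission
  imports Defs
begin

text \<open>
  The proof turns fullness into the existence of local maps.  A chain map out of a free module of
  rank one with zero differential is a cocycle, and two such maps are homotopic if and only if
  the cocycles are cohomologous.  A pair of classes which witnesses that \<open>q\<close> is full for a triple
  \<open>T\<close> is therefore the same as a local map into \<open>T\<close> from the unit triple with its generators moved to
  quantum degree \<open>q\<close>: the equation between the two reductions is the homotopy condition, and the
  condition on the localized class says that the map is an equivalence after \<open>h\<close> is inverted
  (\<open>locally_full_iff_classes\<close>).  This last point is where the two flavours differ.  The localized
  part of \<open>T\<close> is equivalent to a free module of rank one, so a localized class has a coordinate in
  the ground ring, and the class gives an equivalence precisely when the coordinate is a unit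
  (\<open>localized_class_coordinate\<close>).  Over the integers the units are the generators of the additive
  group, over the field with two elements they are the nonzero elements; these are the two
  conditions in the definitions of fullness (\<open>completely_reduced_full_eq\<close> and
  \<open>oddly_reduced_full_eq\<close>).

  In particular 0 is full for \<open>T\<close> if and only if there is a local map from the unit triple to \<open>T\<close>.
  Local maps compose, hence push full gradings forward (\<open>locally_full_local_map\<close>), and they dualize by
  transposition (\<open>local_map_dual\<close>), so 0 is full for the dual of \<open>T\<close> if and only if there is a local
  map from \<open>T\<close> to the unit triple.  A grading that is full for the unit triple is at most 0.  If \<open>T\<close> is
  trivial, then \<open>T\<close> and its dual have local maps to and from the unit triple, so both maxima are 0.
  Conversely, the full gradings of any triple are bounded above (\<open>locally_full_le\<close>) and nonempty
  (\<open>locally_full_exists\<close>), so a maximum equal to 0 is attained; if this holds for \<open>T\<close> and for its dual,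
  the two resulting local maps make \<open>T\<close> trivial (\<open>trivial_triple_iff\<close>).
\<close>

section \<open>Graded rings and matrices of homogeneous maps\<close>

text \<open>The ground rings, the polynomial ring in \<open>h\<close> and the Laurent ring all occur as coefficients; these
closure properties of the homogeneous parts are what the calculus of graded complexes rests on.\<close>

locale ring_grading =
  fixes G :: "'r::comm_ring_1 grading"
  assumes zero_mem [simp]: "0 \<in> G k"
    and one_mem: "1 \<in> G 0"
    and add_mem: "a \<in> G k \<Longrightarrow> b \<in> G k \<Longrightarrow> a + b \<in> G k"
    and uminus_mem: "a \<in> G k \<Longrightarrow> - a \<in> G k"
    and mult_mem: "a \<in> G k \<Longrightarrow> b \<in> G l \<Longrightarrow> a * b \<in> G (k + l)"
begin

text \<open>Matrix entries and components of cochains are constrained by sets of this conditional shape.\<close>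

lemma deg_add_mem:
  "a \<in> (if c then G k else {0}) \<Longrightarrow> b \<in> (if c then G k else {0}) \<Longrightarrow>
    a + b \<in> (if c then G k else {0})"
  by (auto intro: add_mem split: if_splits)

lemma deg_uminus_mem:
  "a \<in> (if c then G k else {0}) \<Longrightarrow> - a \<in> (if c then G k else {0})"
  by (auto intro: uminus_mem split: if_splits)

lemma sum_mem: "(\<And>x. x \<in> A \<Longrightarrow> f x \<in> G k) \<Longrightarrow> (\<Sum>x\<in>A. f x) \<in> G k"
  by (induction A rule: infinite_finite_induct) (auto intro: add_mem)

end

lemma hom_map_carrier: "hom_map G ab X Y M \<Longrightarrow> M \<in> carrier_mat (rank Y) (rank X)"
  by (simp add: hom_map_def)

lemma is_cplx_carrier: "is_cplx G X \<Longrightarrow> diff X \<in> carrier_mat (rank X) (rank X)"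
  by (simp add: is_cplx_def hom_map_def)

lemma chain_map_carrier: "chain_map G X Y M \<Longrightarrow> M \<in> carrier_mat (rank Y) (rank X)"
  by (simp add: chain_map_def hom_map_def)

context ring_grading
begin

lemma hom_map_add:
  assumes "hom_map G ab X Y M" "hom_map G ab X Y N"
  shows "hom_map G ab X Y (M + N)"
  unfolding hom_map_def
proof (intro conjI allI impI)
  fix i j assume ij: "i < rank Y" "j < rank X"
  then have "(M + N) $$ (i, j) = M $$ (i, j) + N $$ (i, j)"
    using hom_map_carrier[OF assms(2)] by simp
  then show "(M + N) $$ (i, j) \<in> (if hdeg Y i = hdeg X j + fst ab then G (qdeg X j + snd ab - qdeg Y i) else {0})"
    using assms ij by (simp only: hom_map_def deg_add_mem)
qed (use hom_map_carrier[OF assms(2)] in simp)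

lemma hom_map_uminus:
  assumes "hom_map G ab X Y M"
  shows "hom_map G ab X Y (- M)"
  unfolding hom_map_def
proof (intro conjI allI impI)
  fix i j assume ij: "i < rank Y" "j < rank X"
  then have "(- M) $$ (i, j) = - M $$ (i, j)"
    using hom_map_carrier[OF assms] by simp
  then show "(- M) $$ (i, j) \<in> (if hdeg Y i = hdeg X j + fst ab then G (qdeg X j + snd ab - qdeg Y i) else {0})"
    using assms ij by (simp only: hom_map_def deg_uminus_mem)
qed (use hom_map_carrier[OF assms] in simp)

lemma hom_map_zero: "hom_map G ab X Y (0\<^sub>m (rank Y) (rank X))"
  by (auto simp: hom_map_def)

lemma hom_map_one: "hom_map G (0, 0) X X (1\<^sub>m (rank X))"
  by (auto simp: hom_map_def one_mem)

text \<open>The bidegree of the composite is given by variables with equations, so that the rule also applies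
to literal bidegrees such as \<open>(1, 0)\<close> or \<open>(-1, 0)\<close>.\<close>

lemma hom_map_mult:
  assumes M: "hom_map G (a, b) X Y M" and N: "hom_map G (a', b') Y Z N"
    and a'': "a'' = a + a'" and b'': "b'' = b + b'"
  shows "hom_map G (a'', b'') X Z (N * M)"
  unfolding hom_map_def
proof (intro conjI allI impI)
  show "N * M \<in> carrier_mat (rank Z) (rank X)"
    using hom_map_carrier[OF M] hom_map_carrier[OF N] by simp
  fix i k assume i: "i < rank Z" and k: "k < rank X"
  have NM: "(N * M) $$ (i, k) = (\<Sum>j<rank Y. N $$ (i, j) * M $$ (j, k))"
    using hom_map_carrier[OF M] hom_map_carrier[OF N] i k
    by (simp add: scalar_prod_def lessThan_atLeast0)
  have *: "N $$ (i, j) * M $$ (j, k) \<in>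
      (if hdeg Z i = hdeg X k + a'' then G (qdeg X k + b'' - qdeg Z i) else {0})" if "j < rank Y" for j
  proof (cases "N $$ (i, j) = 0 \<or> M $$ (j, k) = 0")
    case False
    then have "N $$ (i, j) \<in> G (qdeg Y j + b' - qdeg Z i)" "M $$ (j, k) \<in> G (qdeg X k + b - qdeg Y j)"
      "hdeg Z i = hdeg Y j + a'" "hdeg Y j = hdeg X k + a"
      using M N i k that by (auto simp: hom_map_def split: if_splits)
    then show ?thesis
      using mult_mem[of "N $$ (i, j)" "qdeg Y j + b' - qdeg Z i" "M $$ (j, k)" "qdeg X k + b - qdeg Y j"]
      by (simp add: a'' b'' algebra_simps)
  qed auto
  show "(N * M) $$ (i, k) \<in>
      (if hdeg Z i = hdeg X k + fst (a'', b'') then G (qdeg X k + snd (a'', b'') - qdeg Z i) else {0})"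
  proof (cases "hdeg Z i = hdeg X k + a''")
    case True
    then show ?thesis using * by (auto simp: NM intro!: sum_mem)
  next
    case False
    then show ?thesis using * by (auto simp: NM intro!: sum.neutral)
  qed
qed

end

section \<open>Chain maps up to homotopy\<close>

context ring_grading
begin

lemma chain_map_one: "is_cplx G X \<Longrightarrow> chain_map G X X (1\<^sub>m (rank X))"
  using is_cplx_carrier[of G X] by (simp add: chain_map_def hom_map_one)

lemma chain_map_comp:
  assumes M: "chain_map G X Y M" and N: "chain_map G Y Z N"
    and X: "is_cplx G X" and Y: "is_cplx G Y" and Z: "is_cplx G Z"
  shows "chain_map G X Z (N * M)"
proof -
  note c = is_cplx_carrier[OF X] is_cplx_carrier[OF Y] is_cplx_carrier[OF Z]
    chain_map_carrier[OF M] chain_map_carrier[OF N]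
  have "diff Z * (N * M) = (diff Z * N) * M" using c by simp
  also have "\<dots> = N * (diff Y * M)" using N c by (simp add: chain_map_def)
  also have "\<dots> = (N * M) * diff X" using M c by (simp add: chain_map_def)
  finally show ?thesis
    using M N by (auto simp: chain_map_def intro: hom_map_mult)
qed

lemma homotopic_refl:
  assumes "is_cplx G X" "is_cplx G Y" "M \<in> carrier_mat (rank Y) (rank X)"
  shows "homotopic G X Y M M"
  unfolding homotopic_def
  using assms is_cplx_carrier[of G X] is_cplx_carrier[of G Y]
  by (intro exI[of _ "0\<^sub>m (rank Y) (rank X)"]) (auto simp: hom_map_zero)

lemma homotopic_sym:
  assumes X: "is_cplx G X" and Y: "is_cplx G Y" and H: "homotopic G X Y M N"
    and M: "M \<in> carrier_mat (rank Y) (rank X)" and N: "N \<in> carrier_mat (rank Y) (rank X)"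
  shows "homotopic G X Y N M"
proof -
  obtain K where K: "hom_map G (-1, 0) X Y K" and eq: "M - N = diff Y * K + K * diff X"
    using H by (auto simp: homotopic_def)
  note c = is_cplx_carrier[OF X] is_cplx_carrier[OF Y] hom_map_carrier[OF K]
  have "N - M = - (M - N)" using M N by auto
  also have "\<dots> = - (diff Y * K) - K * diff X"
    unfolding eq using c by (subst uminus_add_minus_mat[of _ "rank Y" "rank X"]) auto
  also have "\<dots> = diff Y * (- K) + (- K) * diff X"
    using c by (subst minus_add_uminus_mat[of _ "rank Y" "rank X"]) auto
  finally show ?thesis using hom_map_uminus[OF K] by (auto simp: homotopic_def)
qed

lemma homotopic_trans:
  assumes X: "is_cplx G X" and Y: "is_cplx G Y"
    and H: "homotopic G X Y M N" and H': "homotopic G X Y N P"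
    and M: "M \<in> carrier_mat (rank Y) (rank X)" and N: "N \<in> carrier_mat (rank Y) (rank X)"
    and P: "P \<in> carrier_mat (rank Y) (rank X)"
  shows "homotopic G X Y M P"
proof -
  obtain K where K: "hom_map G (-1, 0) X Y K" and eq: "M - N = diff Y * K + K * diff X"
    using H by (auto simp: homotopic_def)
  obtain L where L: "hom_map G (-1, 0) X Y L" and eq': "N - P = diff Y * L + L * diff X"
    using H' by (auto simp: homotopic_def)
  note c = is_cplx_carrier[OF X] is_cplx_carrier[OF Y] hom_map_carrier[OF K] hom_map_carrier[OF L]
  have "M - P = (M - N) + (N - P)" using M N P by auto
  also have "\<dots> = (diff Y * K + diff Y * L) + (K * diff X + L * diff X)"
    unfolding eq eq' using c by (intro eq_matI) auto
  also have "\<dots> = diff Y * (K + L) + (K + L) * diff X"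
    using c by (simp add: mult_add_distrib_mat[of _ "rank Y" "rank Y"] add_mult_distrib_mat[of _ "rank Y" "rank X"])
  finally show ?thesis using hom_map_add[OF K L] by (auto simp: homotopic_def)
qed

text \<open>Since \<open>B\<close> commutes with the differentials, it carries a homotopy \<open>K\<close> to the homotopy \<open>B * K\<close>;
precomposition works in the same way.\<close>

lemma homotopic_comp_left:
  assumes X: "is_cplx G X" and Y: "is_cplx G Y" and Z: "is_cplx G Z"
    and B: "chain_map G Y Z B" and H: "homotopic G X Y M N"
    and M: "M \<in> carrier_mat (rank Y) (rank X)" and N: "N \<in> carrier_mat (rank Y) (rank X)"
  shows "homotopic G X Z (B * M) (B * N)"
proof -
  obtain K where K: "hom_map G (-1, 0) X Y K" and eq: "M - N = diff Y * K + K * diff X"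
    using H by (auto simp: homotopic_def)
  note c = is_cplx_carrier[OF X] is_cplx_carrier[OF Y] is_cplx_carrier[OF Z]
    hom_map_carrier[OF K] chain_map_carrier[OF B]
  have "B * M - B * N = B * (M - N)"
    using c M N by (intro mult_minus_distrib_mat[symmetric]) auto
  also have "\<dots> = B * (diff Y * K) + B * (K * diff X)"
    unfolding eq using c by (intro mult_add_distrib_mat) auto
  also have "B * (diff Y * K) = (B * diff Y) * K" using c by simp
  also have "\<dots> = (diff Z * B) * K" using B by (simp add: chain_map_def)
  also have "\<dots> = diff Z * (B * K)" using c by simp
  also have "B * (K * diff X) = (B * K) * diff X" using c by simp
  finally show ?thesis
    using hom_map_mult[OF K, of 0 0 Z B] B by (auto simp: homotopic_def chain_map_def)
qed

lemma homotopic_comp_right: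
  assumes X: "is_cplx G X" and Y: "is_cplx G Y" and W: "is_cplx G W"
    and A: "chain_map G W X A" and H: "homotopic G X Y M N"
    and M: "M \<in> carrier_mat (rank Y) (rank X)" and N: "N \<in> carrier_mat (rank Y) (rank X)"
  shows "homotopic G W Y (M * A) (N * A)"
proof -
  obtain K where K: "hom_map G (-1, 0) X Y K" and eq: "M - N = diff Y * K + K * diff X"
    using H by (auto simp: homotopic_def)
  note c = is_cplx_carrier[OF X] is_cplx_carrier[OF Y] is_cplx_carrier[OF W]
    hom_map_carrier[OF K] chain_map_carrier[OF A]
  have "M * A - N * A = (M - N) * A"
    using c M N by (intro minus_mult_distrib_mat[symmetric]) auto
  also have "\<dots> = (diff Y * K) * A + (K * diff X) * A"
    unfolding eq using c by (intro add_mult_distrib_mat) auto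
  also have "(K * diff X) * A = K * (diff X * A)" using c by simp
  also have "\<dots> = K * (A * diff W)" using A by (simp add: chain_map_def)
  also have "\<dots> = (K * A) * diff W" using c by simp
  also have "(diff Y * K) * A = diff Y * (K * A)" using c by simp
  finally show ?thesis
    using hom_map_mult[OF _ K, of 0 0 W A] A by (auto simp: homotopic_def chain_map_def)
qed

lemma homotopy_equiv_id: "is_cplx G X \<Longrightarrow> homotopy_equiv G X X (1\<^sub>m (rank X))"
  unfolding homotopy_equiv_def homotopy_inverse_def
  by (auto intro!: exI[of _ "1\<^sub>m (rank X)"] chain_map_one homotopic_refl)

lemma homotopy_inverse_equiv:
  "chain_map G X Y f \<Longrightarrow> homotopy_inverse G X Y f g \<Longrightarrow> homotopy_equiv G Y X g"
  by (auto simp: homotopy_equiv_def homotopy_inverse_def)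

text \<open>One half of the composition of homotopy equivalences, used once for each of the two
  composites with an inverse.\<close>

lemma homotopic_one_comp:
  assumes X: "is_cplx G X" and Y: "is_cplx G Y" and Z: "is_cplx G Z"
    and f: "chain_map G X Y f" and g: "chain_map G Y X g"
    and f': "chain_map G Y Z f'" and g': "chain_map G Z Y g'"
    and gf: "homotopic G X X (g * f) (1\<^sub>m (rank X))"
    and gf': "homotopic G Y Y (g' * f') (1\<^sub>m (rank Y))"
  shows "homotopic G X X ((g * g') * (f' * f)) (1\<^sub>m (rank X))"
proof -
  note c = chain_map_carrier[OF f] chain_map_carrier[OF g] chain_map_carrier[OF f'] chain_map_carrier[OF g']
  have "homotopic G X Y (g' * f' * f) (1\<^sub>m (rank Y) * f)"
    by (rule homotopic_comp_right[OF Y Y X f gf']) (use c in auto)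
  then have "homotopic G X X (g * (g' * f' * f)) (g * (1\<^sub>m (rank Y) * f))"
    by (rule homotopic_comp_left[OF X Y X g]) (use c in auto)
  moreover have "g * (g' * f' * f) = (g * g') * (f' * f)"
    using c assoc_mult_mat[OF c(4,3,1)]
      assoc_mult_mat[OF c(2,4) mult_carrier_mat[OF c(3,1)]] by simp
  moreover have "g * (1\<^sub>m (rank Y) * f) = g * f" using c by simp
  ultimately have "homotopic G X X ((g * g') * (f' * f)) (g * f)" by simp
  then show ?thesis
    by (rule homotopic_trans[OF X X _ gf]) (use c in auto)
qed

lemma homotopy_equiv_comp:
  assumes X: "is_cplx G X" and Y: "is_cplx G Y" and Z: "is_cplx G Z"
    and f: "homotopy_equiv G X Y f" and f': "homotopy_equiv G Y Z f'"
  shows "homotopy_equiv G X Z (f' * f)"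
proof -
  obtain g where g: "homotopy_inverse G X Y f g" using f by (auto simp: homotopy_equiv_def)
  obtain g' where g': "homotopy_inverse G Y Z f' g'" using f' by (auto simp: homotopy_equiv_def)
  have c: "chain_map G X Y f" "chain_map G Y X g" "chain_map G Y Z f'" "chain_map G Z Y g'"
    using f f' g g' by (auto simp: homotopy_equiv_def homotopy_inverse_def)
  have "homotopy_inverse G X Z (f' * f) (g * g')"
    unfolding homotopy_inverse_def
    using g g' c X Y Z homotopic_one_comp[OF X Y Z c] homotopic_one_comp[OF Z Y X c(4,3,2,1)]
    by (auto simp: homotopy_inverse_def intro: chain_map_comp)
  then show ?thesis using c X Y Z by (auto simp: homotopy_equiv_def intro: chain_map_comp)
qed

text \<open>A homotopy inverse of a map is one of every map homotopic to it.\<close>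

lemma homotopy_equiv_cong:
  assumes X: "is_cplx G X" and Y: "is_cplx G Y"
    and M: "homotopy_equiv G X Y M" and N: "chain_map G X Y N" and H: "homotopic G X Y M N"
  shows "homotopy_equiv G X Y N"
proof -
  obtain g where g: "homotopy_inverse G X Y M g" and Mc: "chain_map G X Y M"
    using M by (auto simp: homotopy_equiv_def)
  have gc: "chain_map G Y X g" using g by (simp add: homotopy_inverse_def)
  note c = chain_map_carrier[OF Mc] chain_map_carrier[OF gc] chain_map_carrier[OF N]
  have H': "homotopic G X Y N M" by (rule homotopic_sym[OF X Y H]) (use c in auto)
  have "homotopic G X X (g * N) (g * M)"
    by (rule homotopic_comp_left[OF X Y X gc H']) (use c in auto)
  then have 1: "homotopic G X X (g * N) (1\<^sub>m (rank X))"
    by (rule homotopic_trans[OF X X]) (use g c in \<open>auto simp: homotopy_inverse_def\<close>)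
  have "homotopic G Y Y (N * g) (M * g)"
    by (rule homotopic_comp_right[OF X Y Y gc H']) (use c in auto)
  then have 2: "homotopic G Y Y (N * g) (1\<^sub>m (rank Y))"
    by (rule homotopic_trans[OF Y Y]) (use g c in \<open>auto simp: homotopy_inverse_def\<close>)
  show ?thesis
    using 1 2 gc N by (auto simp: homotopy_equiv_def homotopy_inverse_def)
qed

end

section \<open>Duals and base change\<close>

lemma rank_dual [simp]: "rank (dual_cplx X) = rank X"
  by (simp add: dual_cplx_def)

lemma dual_degs: "i < rank X \<Longrightarrow> gens (dual_cplx X) ! i = (- hdeg X i, - qdeg X i)"
  by (simp add: dual_cplx_def split: prod.split)

lemma diff_dual [simp]: "diff (dual_cplx X) = transpose_mat (diff X)"
  by (simp add: dual_cplx_def)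

text \<open>Transposition exchanges source and target while the dual negates both degrees, so the degree of
a map is preserved.\<close>

lemma hom_map_dual:
  assumes "hom_map G ab X Y M"
  shows "hom_map G ab (dual_cplx Y) (dual_cplx X) (transpose_mat M)"
  unfolding hom_map_def
proof (intro conjI allI impI)
  have M: "M \<in> carrier_mat (rank Y) (rank X)" using assms by (rule hom_map_carrier)
  then show "transpose_mat M \<in> carrier_mat (rank (dual_cplx X)) (rank (dual_cplx Y))" by simp
  fix i j assume "i < rank (dual_cplx X)" "j < rank (dual_cplx Y)"
  then have ij: "i < rank X" "j < rank Y" by simp_all
  have "M $$ (j, i) \<in> (if hdeg Y j = hdeg X i + fst ab
                       then G (qdeg X i + snd ab - qdeg Y j) else {0})"
    using assms ij unfolding hom_map_def by blast
  moreover have "transpose_mat M $$ (i, j) = M $$ (j, i)" using ij M by simp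
  moreover have "hdeg (dual_cplx X) i = hdeg (dual_cplx Y) j + fst ab \<longleftrightarrow> hdeg Y j = hdeg X i + fst ab"
    using ij by (simp add: dual_degs) arith
  moreover have "qdeg (dual_cplx Y) j + snd ab - qdeg (dual_cplx X) i = qdeg X i + snd ab - qdeg Y j"
    using ij by (simp add: dual_degs)
  ultimately show "transpose_mat M $$ (i, j) \<in> (if hdeg (dual_cplx X) i = hdeg (dual_cplx Y) j + fst ab
                       then G (qdeg (dual_cplx Y) j + snd ab - qdeg (dual_cplx X) i) else {0})"
    by presburger
qed

lemma is_cplx_dual: "is_cplx G X \<Longrightarrow> is_cplx G (dual_cplx X)"
proof -
  assume X: "is_cplx G X"
  have "transpose_mat (diff X) * transpose_mat (diff X) = transpose_mat (diff X * diff X)"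
    using is_cplx_carrier[OF X] by (simp add: transpose_mult)
  then show ?thesis using X by (simp add: is_cplx_def hom_map_dual)
qed

lemma chain_map_dual:
  assumes M: "chain_map G X Y M" and X: "is_cplx G X" and Y: "is_cplx G Y"
  shows "chain_map G (dual_cplx Y) (dual_cplx X) (transpose_mat M)"
proof -
  note c = is_cplx_carrier[OF X] is_cplx_carrier[OF Y] chain_map_carrier[OF M]
  have "transpose_mat (diff X) * transpose_mat M = transpose_mat (M * diff X)"
    using c by (simp add: transpose_mult)
  also have "M * diff X = diff Y * M" using M by (simp add: chain_map_def)
  also have "transpose_mat (diff Y * M) = transpose_mat M * transpose_mat (diff Y)"
    using c by (simp add: transpose_mult)
  finally show ?thesis using M by (simp add: chain_map_def hom_map_dual)
qed

lemma homotopic_dual: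
  assumes H: "homotopic G X Y M N" and X: "is_cplx G X" and Y: "is_cplx G Y"
    and M: "M \<in> carrier_mat (rank Y) (rank X)" and N: "N \<in> carrier_mat (rank Y) (rank X)"
  shows "homotopic G (dual_cplx Y) (dual_cplx X) (transpose_mat M) (transpose_mat N)"
proof -
  obtain K where K: "hom_map G (-1, 0) X Y K" and eq: "M - N = diff Y * K + K * diff X"
    using H by (auto simp: homotopic_def)
  note c = is_cplx_carrier[OF X] is_cplx_carrier[OF Y] hom_map_carrier[OF K]
  have "transpose_mat M - transpose_mat N = transpose_mat (M - N)"
    using M N by (simp add: transpose_minus)
  also have "\<dots> = transpose_mat (diff Y * K) + transpose_mat (K * diff X)"
    unfolding eq using c by (intro transpose_add) auto
  also have "\<dots> = transpose_mat (diff X) * transpose_mat K + transpose_mat K * transpose_mat (diff Y)"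
    using c by (simp add: transpose_mult comm_add_mat[of _ "rank X" "rank Y"])
  finally show ?thesis using hom_map_dual[OF K] by (auto simp: homotopic_def)
qed

text \<open>Transposing the two homotopies exchanges their roles: the transpose of \<open>g\<close> is an inverse of the
transpose of \<open>f\<close>.\<close>

lemma homotopy_equiv_dual:
  assumes f: "chain_map G X Y f" and g: "homotopy_inverse G X Y f g"
    and X: "is_cplx G X" and Y: "is_cplx G Y"
  shows "homotopy_equiv G (dual_cplx Y) (dual_cplx X) (transpose_mat f)"
proof -
  have gc: "chain_map G Y X g" using g by (simp add: homotopy_inverse_def)
  note c = chain_map_carrier[OF f] chain_map_carrier[OF gc]
  have "homotopic G (dual_cplx Y) (dual_cplx Y) (transpose_mat g * transpose_mat f) (1\<^sub>m (rank Y))"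
    using homotopic_dual[of G Y Y "f * g" "1\<^sub>m (rank Y)"] g X Y c
    by (simp add: homotopy_inverse_def transpose_mult)
  moreover have "homotopic G (dual_cplx X) (dual_cplx X) (transpose_mat f * transpose_mat g) (1\<^sub>m (rank X))"
    using homotopic_dual[of G X X "g * f" "1\<^sub>m (rank X)"] g X Y c
    by (simp add: homotopy_inverse_def transpose_mult)
  ultimately show ?thesis
    using chain_map_dual[OF f X Y] chain_map_dual[OF gc Y X]
    by (auto simp: homotopy_equiv_def homotopy_inverse_def)
qed

text \<open>The reductions modulo 2 and modulo \<open>(2, h)\<close> and the localization at \<open>h\<close> are all changes of
coefficients along graded ring homomorphisms.\<close>

locale graded_hom = comm_ring_hom hom for hom :: "'r::comm_ring_1 \<Rightarrow> 's::comm_ring_1" +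
  fixes G :: "'r grading" and G' :: "'s grading"
  assumes hom_mem: "a \<in> G k \<Longrightarrow> hom a \<in> G' k"
begin

abbreviation bc :: "'r cplx \<Rightarrow> 's cplx" where "bc \<equiv> base_change hom"

lemma deg_hom_mem:
  "a \<in> (if c then G k else {0}) \<Longrightarrow> hom a \<in> (if c then G' k else {0})"
  by (auto intro: hom_mem split: if_splits)

lemma hom_map_base_change:
  assumes "hom_map G ab X Y M"
  shows "hom_map G' ab (bc X) (bc Y) (map_mat hom M)"
  unfolding hom_map_def base_change_def cplx.simps
proof (intro conjI allI impI)
  fix i j assume ij: "i < rank Y" "j < rank X"
  then have "map_mat hom M $$ (i, j) = hom (M $$ (i, j))"
    using hom_map_carrier[OF assms] by simp
  then show "map_mat hom M $$ (i, j) \<in> (if hdeg Y i = hdeg X j + fst ab then G' (qdeg X j + snd ab - qdeg Y i) else {0})"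
    using assms ij by (simp only: hom_map_def deg_hom_mem)
qed (use hom_map_carrier[OF assms] in simp)

lemma is_cplx_base_change:
  assumes X: "is_cplx G X"
  shows "is_cplx G' (bc X)"
proof -
  have "map_mat hom (diff X) * map_mat hom (diff X) = map_mat hom (diff X * diff X)"
    using is_cplx_carrier[OF X] by (simp add: mat_hom_mult)
  also have "\<dots> = 0\<^sub>m (rank X) (rank X)" using X by (auto simp: is_cplx_def)
  finally show ?thesis
    using X hom_map_base_change[of "(1, 0)" X X "diff X"] by (simp add: is_cplx_def base_change_def)
qed

lemma chain_map_base_change:
  assumes X: "is_cplx G X" and Y: "is_cplx G Y" and M: "chain_map G X Y M"
  shows "chain_map G' (bc X) (bc Y) (map_mat hom M)"
proof -
  note c = is_cplx_carrier[OF X] is_cplx_carrier[OF Y] chain_map_carrier[OF M]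
  have "map_mat hom (diff Y) * map_mat hom M = map_mat hom (diff Y * M)"
    using c by (simp add: mat_hom_mult)
  also have "\<dots> = map_mat hom (M * diff X)" using M by (simp add: chain_map_def)
  also have "\<dots> = map_mat hom M * map_mat hom (diff X)" using c by (simp add: mat_hom_mult)
  finally show ?thesis
    using M hom_map_base_change[of "(0, 0)" X Y M] by (simp add: chain_map_def base_change_def)
qed

end

lemma base_change_dual: "base_change \<phi> (dual_cplx X) = dual_cplx (base_change \<phi> X)"
  by (simp add: base_change_def dual_cplx_def map_mat_transpose)

lemma rank_base_change [simp]: "rank (base_change \<phi> X) = rank X"
  by (simp add: base_change_def)

section \<open>The gradings of the coefficient rings\<close>

lemma ring_grading_ground: "ring_grading (ground_gr :: 'k::comm_ring_1 grading)"
  by unfold_locales (auto simp: ground_gr_def split: if_splits)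

lemma ring_grading_poly: "ring_grading (poly_gr :: 'k::comm_ring_1 poly grading)"
proof unfold_locales
  fix a b :: "'k poly" and k l
  assume ab: "a \<in> poly_gr k" "b \<in> poly_gr l"
  show "a * b \<in> poly_gr (k + l)"
    unfolding poly_gr_def
  proof (intro CollectI allI impI)
    fix n assume "coeff (a * b) n \<noteq> 0"
    then obtain i where i: "i \<le> n" "coeff a i * coeff b (n - i) \<noteq> 0"
      unfolding coeff_mult by (auto elim: sum.not_neutral_contains_not_neutral)
    then have "coeff a i \<noteq> 0" "coeff b (n - i) \<noteq> 0" by auto
    then have "k = - 2 * int i" "l = - 2 * int (n - i)"
      using ab by (auto simp: poly_gr_def)
    then show "k + l = - 2 * int n" using i(1) by simp
  qed
next
  fix a b :: "'k poly" and k
  assume ab: "a \<in> poly_gr k" "b \<in> poly_gr k"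
  show "a + b \<in> poly_gr k"
    unfolding poly_gr_def
  proof (intro CollectI allI impI)
    fix n assume "coeff (a + b) n \<noteq> 0"
    then have "coeff a n \<noteq> 0 \<or> coeff b n \<noteq> 0" by auto
    then show "k = - 2 * int n" using ab by (auto simp: poly_gr_def)
  qed
next
  fix a :: "'k poly" and k
  assume "a \<in> poly_gr k"
  then show "- a \<in> poly_gr k" unfolding poly_gr_def by simp
next
  show "(1 :: 'k poly) \<in> poly_gr 0"
    unfolding poly_gr_def by (simp add: coeff_1)
qed (simp add: poly_gr_def)

lemma ring_grading_laurent: "ring_grading (laurent_gr :: 'k::comm_ring_1 laurent grading)"
proof unfold_locales
  fix a b :: "'k laurent" and k l
  assume ab: "a \<in> laurent_gr k" "b \<in> laurent_gr l"
  show "a * b \<in> laurent_gr (k + l)"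
    using ab keys_mult[of a b] by (fastforce simp: laurent_gr_def)
next
  fix a b :: "'k laurent" and k
  assume ab: "a \<in> laurent_gr k" "b \<in> laurent_gr k"
  then show "a + b \<in> laurent_gr k"
    using keys_add[of a b] by (fastforce simp: laurent_gr_def)
next
  fix a :: "'k laurent" and k
  assume "a \<in> laurent_gr k"
  then show "- a \<in> laurent_gr k" unfolding laurent_gr_def by simp
next
  show "(1 :: 'k laurent) \<in> laurent_gr 0"
    unfolding laurent_gr_def by (simp add: keys_one)
qed (simp add: laurent_gr_def)

interpretation ground: ring_grading "ground_gr :: 'k::comm_ring_1 grading"
  by (rule ring_grading_ground)

interpretation poly: ring_grading "poly_gr :: 'k::comm_ring_1 poly grading"
  by (rule ring_grading_poly)

interpretation laurent: ring_grading "laurent_gr :: 'k::comm_ring_1 laurent grading"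
  by (rule ring_grading_laurent)

lemma lookup_to_laurent:
  "Poly_Mapping.lookup (to_laurent p) k = (if k \<ge> 0 then coeff p (nat k) else 0)"
proof -
  have "Poly_Mapping.lookup (to_laurent p) k = (\<Sum>n\<le>degree p. if int n = k then coeff p n else 0)"
    unfolding to_laurent_def by (simp add: lookup_sum lookup_single when_def)
  also have "\<dots> = (if k \<ge> 0 then coeff p (nat k) else 0)"
  proof (cases "k \<ge> 0 \<and> nat k \<le> degree p")
    case True
    then have "(\<Sum>n\<le>degree p. if int n = k then coeff p n else 0)
        = (\<Sum>n\<in>{nat k}. coeff p n)"
      by (intro sum.mono_neutral_cong_right) auto
    then show ?thesis using True by simp
  next
    case False
    then have "(\<Sum>n\<le>degree p. if int n = k then coeff p n else 0) = 0"
      by (intro sum.neutral) auto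
    then show ?thesis using False by (auto simp: coeff_eq_0)
  qed
  finally show ?thesis .
qed

lemma to_laurent_add: "to_laurent (p + q) = to_laurent p + to_laurent q"
  by (rule poly_mapping_eqI) (simp add: lookup_to_laurent lookup_add)

lemma to_laurent_0: "to_laurent 0 = 0"
  by (rule poly_mapping_eqI) (simp add: lookup_to_laurent)

lemma to_laurent_monom: "to_laurent (monom c n) = Poly_Mapping.single (int n) c"
  by (rule poly_mapping_eqI) (auto simp: lookup_to_laurent lookup_single when_def)

lemma to_laurent_sum: "to_laurent (sum f A) = (\<Sum>x\<in>A. to_laurent (f x))"
  by (induction A rule: infinite_finite_induct) (simp_all add: to_laurent_0 to_laurent_add)

lemma to_laurent_mult: "to_laurent (p * q) = to_laurent p * to_laurent q"
proof -
  \<comment> \<open>Both sides are bilinear and monomials are sent to monomials.\<close>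
  have "p * q = (\<Sum>i\<le>degree p. \<Sum>j\<le>degree q. monom (coeff p i * coeff q j) (i + j))"
    by (subst (1) poly_as_sum_of_monoms[of p, symmetric], subst (1) poly_as_sum_of_monoms[of q, symmetric])
      (simp add: sum_product mult_monom)
  then have "to_laurent (p * q)
      = (\<Sum>i\<le>degree p. \<Sum>j\<le>degree q. Poly_Mapping.single (int i + int j) (coeff p i * coeff q j))"
    by (simp add: to_laurent_sum to_laurent_monom)
  also have "\<dots> = to_laurent p * to_laurent q"
    by (simp add: to_laurent_def sum_product mult_single)
  finally show ?thesis .
qed

lemma to_laurent_inj: "to_laurent p = to_laurent q \<Longrightarrow> p = q"
  by (rule poly_eqI) (metis lookup_to_laurent nat_int of_nat_0_le_iff)

lemma graded_hom_to_laurent: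
  "graded_hom (to_laurent :: 'k::comm_ring_1 poly \<Rightarrow> 'k laurent) poly_gr laurent_gr"
proof unfold_locales
  show "to_laurent 1 = (1 :: 'k laurent)"
    using to_laurent_monom[of "1::'k" 0] by (simp add: monom_0 flip: one_pCons)
  show "to_laurent a \<in> laurent_gr k" if "a \<in> poly_gr k" for a :: "'k poly" and k
    unfolding laurent_gr_def
  proof (intro CollectI ballI)
    fix n assume "n \<in> Poly_Mapping.keys (to_laurent a)"
    then have "n \<ge> 0" "coeff a (nat n) \<noteq> 0"
      by (auto simp: in_keys_iff lookup_to_laurent split: if_splits)
    then show "k = - 2 * n" using that by (auto simp: poly_gr_def)
  qed
qed (simp_all add: to_laurent_0 to_laurent_add to_laurent_mult)

text \<open>Evaluation at \<open>h = 0\<close> keeps only the constant coefficient, which has degree 0, so the target is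
graded by degree 0 alone.\<close>

lemma graded_hom_red_S:
  assumes "comm_ring_hom (r :: 'k::comm_ring_1 \<Rightarrow> bit)"
  shows "graded_hom (red_S r) poly_gr ground_gr"
proof -
  interpret r: comm_ring_hom r by fact
  have "comm_ring_hom (red_S r)"
  proof
    show "red_S r (p + q) = red_S r p + red_S r q" for p q
      unfolding red_S_def poly_add by (rule r.hom_add)
    show "red_S r (p * q) = red_S r p * red_S r q" for p q
      unfolding red_S_def poly_mult by (rule r.hom_mult)
    show "red_S r 0 = 0"
      unfolding red_S_def poly_0 by (rule r.hom_zero)
    show "red_S r 1 = 1"
      unfolding red_S_def poly_1 by (rule r.hom_one)
  qed
  moreover have "red_S r a \<in> ground_gr k" if "a \<in> poly_gr k" for a k
  proof (cases "k = 0")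
    case False
    have "coeff a 0 \<noteq> 0 \<longrightarrow> k = - 2 * int 0" using that unfolding poly_gr_def by blast
    then have "poly a 0 = 0" using False by (simp add: poly_0_coeff_0)
    then show ?thesis using r.hom_zero by (simp add: red_S_def ground_gr_def)
  qed (simp add: ground_gr_def)
  ultimately show ?thesis unfolding graded_hom_def graded_hom_axioms_def by blast
qed

lemma graded_hom_mod2: "graded_hom (of_int :: int \<Rightarrow> bit) ground_gr ground_gr"
  by unfold_locales (auto simp: ground_gr_def split: if_splits)

interpretation loc: graded_hom to_laurent "poly_gr :: 'k::comm_ring_1 poly grading" laurent_gr
  by (rule graded_hom_to_laurent)

interpretation mod2: graded_hom "of_int :: int \<Rightarrow> bit" ground_gr ground_gr
  by (rule graded_hom_mod2)

section \<open>Cocycles as chain maps out of a free module of rank one\<close>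

text \<open>Cochains become matrices with one column, so that the calculus of chain maps applies to them.\<close>

definition col_mat :: "'r vec \<Rightarrow> 'r mat" where
  "col_mat v = mat (dim_vec v) 1 (\<lambda>(i, j). v $ i)"

lemma col_mat_dims [simp]: "dim_row (col_mat v) = dim_vec v" "dim_col (col_mat v) = 1"
  by (simp_all add: col_mat_def)

lemma col_mat_carrier_iff: "col_mat v \<in> carrier_mat n 1 \<longleftrightarrow> v \<in> carrier_vec n"
  by (metis carrier_matD(1) carrier_matI carrier_vecD carrier_vecI col_mat_dims)

lemma col_mat_carrier: "v \<in> carrier_vec n \<Longrightarrow> col_mat v \<in> carrier_mat n 1"
  by (auto simp: col_mat_def)

lemma one_column_mat: "M \<in> carrier_mat n 1 \<Longrightarrow> M = col_mat (col M 0)"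
  by (rule eq_matI) (auto simp: col_mat_def)

lemma mult_col_mat: "A \<in> carrier_mat m n \<Longrightarrow> v \<in> carrier_vec n \<Longrightarrow> A * col_mat v = col_mat (A *\<^sub>v v)"
  by (rule eq_matI) (auto simp: col_mat_def scalar_prod_def)

lemma minus_col_mat: "v \<in> carrier_vec n \<Longrightarrow> w \<in> carrier_vec n \<Longrightarrow> col_mat v - col_mat w = col_mat (v - w)"
  by (rule eq_matI) (auto simp: col_mat_def)

lemma map_col_mat: "map_mat f (col_mat v) = col_mat (map_vec f v)"
  by (rule eq_matI) (auto simp: col_mat_def)

lemma col_mat_inject [simp]: "col_mat v = col_mat w \<longleftrightarrow> v = w"
proof
  assume eq: "col_mat v = col_mat w"
  then have d: "dim_vec v = dim_vec w" by (metis col_mat_def dim_row_mat(1))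
  show "v = w"
  proof (rule eq_vecI)
    fix i assume "i < dim_vec w"
    then show "v $ i = w $ i"
      using d arg_cong[OF eq, of "\<lambda>A. A $$ (i, 0)"] by (simp add: col_mat_def)
  qed (use d in simp)
qed simp

lemma rank_one_simps [simp]:
  "gens (rank_one ab) = [ab]" "diff (rank_one ab) = 0\<^sub>m 1 1"
  by (simp_all add: rank_one_def)

lemma is_cplx_rank_one: "0 \<in> G 0 \<Longrightarrow> is_cplx G (rank_one ab)"
  by (auto simp: is_cplx_def hom_map_def)

lemma cochains_carrier: "v \<in> cochains G X i q \<Longrightarrow> v \<in> carrier_vec (rank X)"
  by (simp add: cochains_def)

lemma cocycles_carrier: "v \<in> cocycles G X i q \<Longrightarrow> v \<in> carrier_vec (rank X)"
  by (simp add: cocycles_def cochains_def)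

text \<open>A homogeneous map out of a free module of rank one is the image of the generator; its bidegree
shifts the bidegree of that image.\<close>

lemma hom_map_rank_one_iff:
  "hom_map G (a, b) (rank_one (i, q)) X (col_mat v) \<longleftrightarrow> v \<in> cochains G X (i + a) (q + b)"
proof -
  let ?D = "\<lambda>k. if hdeg X k = i + a then G (q + b - qdeg X k) else {0}"
  have *: "(\<forall>j<1. col_mat v $$ (k, j) \<in>
        (if hdeg X k = hdeg (rank_one (i, q)) j + fst (a, b)
         then G (qdeg (rank_one (i, q)) j + snd (a, b) - qdeg X k) else {0})) \<longleftrightarrow> v $ k \<in> ?D k"
    if "v \<in> carrier_vec (rank X)" "k < rank X" for k
  proof -
    have "col_mat v $$ (k, 0) = v $ k" using that by (simp add: col_mat_def)
    moreover have "(\<forall>j<1::nat. P j) \<longleftrightarrow> P 0" for P by simp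
    ultimately show ?thesis by (simp only: rank_one_simps nth_Cons_0 fst_conv snd_conv)
  qed
  have r: "rank (rank_one (i, q)) = 1" by simp
  have "hom_map G (a, b) (rank_one (i, q)) X (col_mat v) \<longleftrightarrow>
      v \<in> carrier_vec (rank X) \<and> (\<forall>k<rank X. v $ k \<in> ?D k)"
    unfolding hom_map_def r col_mat_carrier_iff using * by blast
  also have "\<dots> \<longleftrightarrow> v \<in> cochains G X (i + a) (q + b)"
    unfolding cochains_def by blast
  finally show ?thesis .
qed

text \<open>The differential of the source vanishes, so commuting with the differentials means that the image
of the generator is closed.\<close>

lemma chain_map_rank_one_iff:
  assumes "is_cplx G X"
  shows "chain_map G (rank_one (i, q)) X (col_mat v) \<longleftrightarrow> v \<in> cocycles G X i q"
proof (cases "v \<in> cochains G X i q")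
  case True
  note c = is_cplx_carrier[OF assms] cochains_carrier[OF True]
  have *: "0\<^sub>m (rank X) (Suc 0) = col_mat (0\<^sub>v (rank X))"
    by (rule eq_matI) (auto simp: col_mat_def)
  have "col_mat v * 0\<^sub>m 1 1 = 0\<^sub>m (rank X) 1"
    by (rule right_mult_zero_mat) (rule col_mat_carrier[OF c(2)])
  then show ?thesis
    using True c by (simp add: chain_map_def hom_map_rank_one_iff cocycles_def mult_col_mat *)
qed (simp add: chain_map_def hom_map_rank_one_iff cocycles_def)

text \<open>For the same reason a homotopy \<open>K\<close> contributes only \<open>diff X * K\<close>, the coboundary of the image of
the generator under \<open>K\<close>.\<close>

lemma homotopic_rank_one_iff:
  assumes X: "is_cplx G X" and v: "v \<in> carrier_vec (rank X)" and w: "w \<in> carrier_vec (rank X)"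
  shows "homotopic G (rank_one (i, q)) X (col_mat v) (col_mat w) \<longleftrightarrow> v - w \<in> coboundaries G X i q"
proof
  note c = is_cplx_carrier[OF X] v w
  { assume "homotopic G (rank_one (i, q)) X (col_mat v) (col_mat w)"
    then obtain K where K: "hom_map G (-1, 0) (rank_one (i, q)) X K"
      and eq: "col_mat v - col_mat w = diff X * K + K * diff (rank_one (i, q))"
      unfolding homotopic_def by blast
    have Kc: "K \<in> carrier_mat (rank X) 1" using hom_map_carrier[OF K] by simp
    define u where "u = col K 0"
    have u: "u \<in> carrier_vec (rank X)" unfolding u_def by (intro carrier_vecI) (simp add: carrier_matD(1)[OF Kc])
    have Ku: "K = col_mat u" unfolding u_def using Kc by (rule one_column_mat)
    have "col_mat (v - w) = diff X * K + K * 0\<^sub>m 1 1"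
      using eq by (simp add: minus_col_mat[OF v w])
    also have "\<dots> = diff X * K"
      unfolding right_mult_zero_mat[OF Kc] by (rule right_add_zero_mat[OF mult_carrier_mat[OF c(1) Kc]])
    also have "\<dots> = col_mat (diff X *\<^sub>v u)"
      unfolding Ku by (rule mult_col_mat[OF c(1) u])
    finally have "v - w = diff X *\<^sub>v u" by simp
    moreover have "u \<in> cochains G X (i - 1) q"
      using K hom_map_rank_one_iff[of G "-1" 0 i q X u] by (simp add: Ku)
    ultimately show "v - w \<in> coboundaries G X i q"
      by (simp add: coboundaries_def) }
  { assume "v - w \<in> coboundaries G X i q"
    then obtain u where u: "u \<in> cochains G X (i - 1) q" and eq: "v - w = diff X *\<^sub>v u"
      by (auto simp: coboundaries_def)
    note c' = cochains_carrier[OF u]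
    have "col_mat v - col_mat w = diff X * col_mat u"
      by (simp add: minus_col_mat[OF v w] eq mult_col_mat[OF c(1) c'])
    also have "\<dots> = diff X * col_mat u + col_mat u * 0\<^sub>m 1 1"
      unfolding right_mult_zero_mat[OF col_mat_carrier[OF c']]
      by (rule right_add_zero_mat[OF mult_carrier_mat[OF c(1) col_mat_carrier[OF c']], symmetric])
    finally have "col_mat v - col_mat w = diff X * col_mat u + col_mat u * diff (rank_one (i, q))"
      by simp
    moreover have "hom_map G (-1, 0) (rank_one (i, q)) X (col_mat u)"
      using u by (simp add: hom_map_rank_one_iff)
    ultimately show "homotopic G (rank_one (i, q)) X (col_mat v) (col_mat w)"
      unfolding homotopic_def by blast }
qed

section \<open>Cohomology groups\<close>

definition coh_class :: "'r::comm_ring_1 grading \<Rightarrow> 'r cplx \<Rightarrow> int \<Rightarrow> int \<Rightarrow> 'r vec \<Rightarrow> 'r vec set" where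
  "coh_class G X i q v = coboundaries G X i q #>\<^bsub>monoid_vec TYPE('r) (rank X)\<^esub> v"

lemma mult_mat_zero_vec: "A \<in> carrier_mat m n \<Longrightarrow> A *\<^sub>v 0\<^sub>v n = 0\<^sub>v m"
  by (intro eq_vecI) simp_all

lemma mult_zero_mat_vec: "v \<in> carrier_vec n \<Longrightarrow> 0\<^sub>m m n *\<^sub>v v = 0\<^sub>v m"
  by (intro eq_vecI) simp_all

lemma inv_monoid_vec:
  fixes v :: "'r::ab_group_add vec"
  assumes "v \<in> carrier_vec n"
  shows "inv\<^bsub>monoid_vec TYPE('r) n\<^esub> v = - v"
proof -
  interpret comm_group "monoid_vec TYPE('r) n" by (rule comm_group_vec)
  show ?thesis
    by (rule inv_equality) (use assms in \<open>simp_all add: monoid_vec_simps\<close>)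
qed

lemma subgroup_monoid_vecI:
  fixes A :: "'r::ab_group_add vec set"
  assumes "A \<subseteq> carrier_vec n" "0\<^sub>v n \<in> A" "\<And>v w. v \<in> A \<Longrightarrow> w \<in> A \<Longrightarrow> v + w \<in> A" "\<And>v. v \<in> A \<Longrightarrow> - v \<in> A"
  shows "subgroup A (monoid_vec TYPE('r) n)"
proof -
  interpret comm_group "monoid_vec TYPE('r) n" by (rule comm_group_vec)
  show ?thesis
  proof (rule subgroupI)
    fix a assume "a \<in> A"
    then have "a \<in> carrier_vec n" using assms(1) by (rule subsetD[rotated])
    then show "inv\<^bsub>monoid_vec TYPE('r) n\<^esub> a \<in> A"
      using assms(4)[OF \<open>a \<in> A\<close>] by (simp only: inv_monoid_vec)
  qed (use assms in \<open>simp_all only: monoid_vec_simps, blast+\<close>)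
qed

context ring_grading
begin

lemma cochains_zero: "0\<^sub>v (rank X) \<in> cochains G X i q"
  by (simp add: cochains_def)

lemma cochains_add:
  assumes "v \<in> cochains G X i q" "w \<in> cochains G X i q"
  shows "v + w \<in> cochains G X i q"
  unfolding cochains_def
proof (intro CollectI conjI allI impI)
  show "v + w \<in> carrier_vec (rank X)"
    using cochains_carrier[OF assms(1)] cochains_carrier[OF assms(2)] by (rule add_carrier_vec)
  fix j assume j: "j < rank X"
  then have "(v + w) $ j = v $ j + w $ j" using cochains_carrier[OF assms(2)] by simp
  then show "(v + w) $ j \<in> (if hdeg X j = i then G (q - qdeg X j) else {0})"
    using assms j by (simp only: cochains_def mem_Collect_eq deg_add_mem)
qed

lemma cochains_uminus:
  assumes "v \<in> cochains G X i q"
  shows "- v \<in> cochains G X i q"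
  unfolding cochains_def
proof (intro CollectI conjI allI impI)
  show "- v \<in> carrier_vec (rank X)"
    using cochains_carrier[OF assms(1)] by simp
  fix j assume j: "j < rank X"
  then have "(- v) $ j = - v $ j" using cochains_carrier[OF assms] by simp
  then show "(- v) $ j \<in> (if hdeg X j = i then G (q - qdeg X j) else {0})"
    using assms j by (simp only: cochains_def mem_Collect_eq deg_uminus_mem)
qed

lemma subgroup_cocycles:
  assumes X: "is_cplx G X"
  shows "subgroup (cocycles G X i q) (monoid_vec TYPE('r) (rank X))"
proof (rule subgroup_monoid_vecI)
  note d = is_cplx_carrier[OF X]
  show "0\<^sub>v (rank X) \<in> cocycles G X i q"
    using mult_mat_zero_vec[OF d] by (simp add: cocycles_def cochains_zero)
  show "v + w \<in> cocycles G X i q" if "v \<in> cocycles G X i q" "w \<in> cocycles G X i q" for v w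
    using that cochains_add mult_add_distrib_mat_vec[OF d cocycles_carrier cocycles_carrier, OF that]
    by (simp add: cocycles_def)
  show "- v \<in> cocycles G X i q" if "v \<in> cocycles G X i q" for v
  proof -
    have "diff X *\<^sub>v (- v) = - (diff X *\<^sub>v v)"
      using d cocycles_carrier[OF that] by (intro eq_vecI) simp_all
    then show ?thesis using that cochains_uminus by (simp add: cocycles_def)
  qed
qed (rule subsetI, rule cocycles_carrier)

lemma subgroup_coboundaries:
  assumes X: "is_cplx G X"
  shows "subgroup (coboundaries G X i q) (monoid_vec TYPE('r) (rank X))"
proof (rule subgroup_monoid_vecI)
  note d = is_cplx_carrier[OF X]
  show "coboundaries G X i q \<subseteq> carrier_vec (rank X)"
    unfolding coboundaries_def using d cochains_carrier mult_mat_vec_carrier by blast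
  note mult_mat_zero_vec[OF d]
  then show "0\<^sub>v (rank X) \<in> coboundaries G X i q"
    unfolding coboundaries_def using cochains_zero by (metis imageI)
  show "v + w \<in> coboundaries G X i q"
    if vw: "v \<in> coboundaries G X i q" "w \<in> coboundaries G X i q" for v w
  proof -
    obtain x y where x: "x \<in> cochains G X (i - 1) q" "v = diff X *\<^sub>v x"
      and y: "y \<in> cochains G X (i - 1) q" "w = diff X *\<^sub>v y"
      using vw unfolding coboundaries_def by blast
    then have "v + w = diff X *\<^sub>v (x + y)"
      using mult_add_distrib_mat_vec[OF d cochains_carrier cochains_carrier, OF x(1) y(1)] by simp
    then show ?thesis unfolding coboundaries_def using cochains_add[OF x(1) y(1)] by blast
  qed
  show "- v \<in> coboundaries G X i q" if v: "v \<in> coboundaries G X i q" for v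
  proof -
    obtain x where x: "x \<in> cochains G X (i - 1) q" "v = diff X *\<^sub>v x"
      using v unfolding coboundaries_def by blast
    then have "- v = diff X *\<^sub>v (- x)"
      using d cochains_carrier[OF x(1)] by (intro eq_vecI) simp_all
    then show ?thesis unfolding coboundaries_def using cochains_uminus[OF x(1)] by blast
  qed
qed

text \<open>That the differential raises the homological degree by one is read off from \<open>hom_map_mult\<close> applied
to a cochain regarded as a map out of a free module of rank one.\<close>

lemma coboundaries_subset_cocycles:
  assumes X: "is_cplx G X"
  shows "coboundaries G X i q \<subseteq> cocycles G X i q"
proof
  note d = is_cplx_carrier[OF X]
  fix v assume "v \<in> coboundaries G X i q"
  then obtain x where x: "x \<in> cochains G X (i - 1) q" "v = diff X *\<^sub>v x"
    unfolding coboundaries_def by blast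
  note xc = cochains_carrier[OF x(1)]
  have "hom_map G (0, 0) (rank_one (i - 1, q)) X (col_mat x)"
    using x(1) by (simp add: hom_map_rank_one_iff)
  then have "hom_map G (1, 0) (rank_one (i - 1, q)) X (diff X * col_mat x)"
    by (rule hom_map_mult) (use X in \<open>simp_all add: is_cplx_def\<close>)
  then have "v \<in> cochains G X i q"
    using hom_map_rank_one_iff[of G 1 0 "i - 1" q X v] by (simp add: mult_col_mat[OF d xc] x(2))
  moreover have "diff X *\<^sub>v v = (diff X * diff X) *\<^sub>v x"
    unfolding x(2) using d xc by simp
  then have "diff X *\<^sub>v v = 0\<^sub>v (rank X)"
    using X mult_zero_mat_vec[OF xc] by (simp add: is_cplx_def)
  ultimately show "v \<in> cocycles G X i q" by (simp add: cocycles_def)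
qed

lemma coboundaries_zero: "is_cplx G X \<Longrightarrow> 0\<^sub>v (rank X) \<in> coboundaries G X i q"
  using subgroup.one_closed[OF subgroup_coboundaries] by (simp add: monoid_vec_simps)

lemma normal_coboundaries:
  assumes X: "is_cplx G X"
  shows "coboundaries G X i q \<lhd> (monoid_vec TYPE('r) (rank X))\<lparr>carrier := cocycles G X i q\<rparr>"
proof -
  interpret comm_group "monoid_vec TYPE('r) (rank X)" by (rule comm_group_vec)
  interpret Z: comm_group "(monoid_vec TYPE('r) (rank X))\<lparr>carrier := cocycles G X i q\<rparr>"
    by (rule group.group_comm_groupI[OF subgroup_imp_group[OF subgroup_cocycles[OF X]]])
      (auto simp: monoid_vec_simps intro: comm_add_vec dest: cocycles_carrier)
  show ?thesis
    by (intro Z.subgroup_imp_normal subgroup_incl subgroup_cocycles subgroup_coboundaries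
        coboundaries_subset_cocycles X)
qed

lemma group_cohomology: "is_cplx G X \<Longrightarrow> group (cohomology G X i q)"
  unfolding cohomology_def by (rule normal.factorgroup_is_group[OF normal_coboundaries])

lemma carrier_cohomology: "carrier (cohomology G X i q) = coh_class G X i q ` cocycles G X i q"
  by (auto simp: cohomology_def FactGroup_def RCOSETS_def coh_class_def r_coset_def)

lemma mult_coh_class:
  assumes X: "is_cplx G X" and "v \<in> cocycles G X i q" "w \<in> cocycles G X i q"
  shows "coh_class G X i q v \<otimes>\<^bsub>cohomology G X i q\<^esub> coh_class G X i q w = coh_class G X i q (v + w)"
  using normal.rcos_sum[OF normal_coboundaries[OF X], of v i q w] assms(2,3)
  by (simp add: cohomology_def FactGroup_def coh_class_def r_coset_def set_mult_def monoid_vec_simps)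

lemma one_cohomology:
  assumes X: "is_cplx G X"
  shows "\<one>\<^bsub>cohomology G X i q\<^esub> = coh_class G X i q (0\<^sub>v (rank X))"
proof -
  interpret comm_group "monoid_vec TYPE('r) (rank X)" by (rule comm_group_vec)
  have "coh_class G X i q (0\<^sub>v (rank X)) = coboundaries G X i q"
    unfolding coh_class_def
    using coset_mult_one[OF subgroup.subset[OF subgroup_coboundaries[OF X, of i q]]]
    by (simp add: monoid_vec_simps)
  then show ?thesis by (simp add: cohomology_def FactGroup_def)
qed

lemma cocycles_zero: "is_cplx G X \<Longrightarrow> 0\<^sub>v (rank X) \<in> cocycles G X i q"
  using coboundaries_subset_cocycles coboundaries_zero by blast

lemma cocycles_add:
  "is_cplx G X \<Longrightarrow> v \<in> cocycles G X i q \<Longrightarrow> w \<in> cocycles G X i q \<Longrightarrow> v + w \<in> cocycles G X i q"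
  using subgroup.m_closed[OF subgroup_cocycles] by (simp add: monoid_vec_simps)

lemma cocycles_uminus:
  "is_cplx G X \<Longrightarrow> v \<in> cocycles G X i q \<Longrightarrow> - v \<in> cocycles G X i q"
  using subgroup.m_inv_closed[OF subgroup_cocycles] inv_monoid_vec[OF cocycles_carrier] by metis

lemma inv_coh_class:
  assumes X: "is_cplx G X" and v: "v \<in> cocycles G X i q"
  shows "inv\<^bsub>cohomology G X i q\<^esub> coh_class G X i q v = coh_class G X i q (- v)"
proof -
  interpret H: group "cohomology G X i q" by (rule group_cohomology[OF X])
  have "- v + v = 0\<^sub>v (rank X)" using cocycles_carrier[OF v] by simp
  then show ?thesis
    using v cocycles_uminus[OF X v]
    by (intro H.inv_equality) (simp_all add: mult_coh_class[OF X] one_cohomology[OF X] carrier_cohomology)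
qed

lemma coh_class_eq_iff:
  assumes X: "is_cplx G X" and v: "v \<in> carrier_vec (rank X)" and w: "w \<in> carrier_vec (rank X)"
  shows "coh_class G X i q v = coh_class G X i q w \<longleftrightarrow> v - w \<in> coboundaries G X i q"
proof -
  let ?V = "monoid_vec TYPE('r) (rank X)"
  interpret comm_group ?V by (rule comm_group_vec)
  note B = subgroup_coboundaries[OF X, of i q]
  have w': "w \<in> carrier ?V" and v': "v \<in> carrier ?V" using v w by (simp_all add: monoid_vec_simps)
  have cl: "coboundaries G X i q #>\<^bsub>?V\<^esub> v = coboundaries G X i q #>\<^bsub>?V\<^esub> w \<longleftrightarrow>
      v \<in> coboundaries G X i q #>\<^bsub>?V\<^esub> w"
    using repr_independence[OF _ w' B] repr_independenceD[OF B v'] rcos_self[OF v' B] by metis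
  have "v \<in> coboundaries G X i q #>\<^bsub>?V\<^esub> w \<longleftrightarrow> (\<exists>b\<in>coboundaries G X i q. v = b + w)"
    by (auto simp: r_coset_def monoid_vec_simps)
  also have "\<dots> \<longleftrightarrow> v - w \<in> coboundaries G X i q"
  proof
    assume "\<exists>b\<in>coboundaries G X i q. v = b + w"
    then obtain b where b: "b \<in> coboundaries G X i q" "v = b + w" by blast
    have "b \<in> carrier_vec (rank X)" using subgroup.subset[OF B] b(1) by (auto simp: monoid_vec_simps)
    then have "v - w = b" using w b(2) by (intro eq_vecI) simp_all
    then show "v - w \<in> coboundaries G X i q" using b by simp
  next
    assume "v - w \<in> coboundaries G X i q"
    moreover have "v = (v - w) + w" using v w by (intro eq_vecI) simp_all
    ultimately show "\<exists>b\<in>coboundaries G X i q. v = b + w" by blast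
  qed
  finally show ?thesis unfolding coh_class_def cl .
qed

text \<open>An additive map of cochains which preserves coboundaries acts on classes through
  representatives; it need not be linear, so that reductions and localization are covered.\<close>

lemma coh_map_class:
  assumes Y: "is_cplx G Y"
    and B: "\<And>b. b \<in> coboundaries G' X i q \<Longrightarrow> \<phi> b \<in> coboundaries G Y i q"
    and add: "\<And>b. b \<in> coboundaries G' X i q \<Longrightarrow> \<phi> (b + v) = \<phi> b + \<phi> v"
    and 0: "0\<^sub>v (rank X) \<in> coboundaries G' X i q"
    and v: "v \<in> carrier_vec (rank X)" and \<phi>v: "\<phi> v \<in> carrier_vec (rank Y)"
  shows "coh_map G Y i q \<phi> (coh_class G' X i q v) = coh_class G Y i q (\<phi> v)"
proof -
  let ?B = "coboundaries G' X i q" and ?B' = "coboundaries G Y i q"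
  note S = subgroup_coboundaries[OF Y, of i q]
  have B'c: "?B' \<subseteq> carrier_vec (rank Y)" using subgroup.subset[OF S] by (simp add: monoid_vec_simps)
  have "coh_map G Y i q \<phi> (coh_class G' X i q v) = {b' + \<phi> (b + v) |b' b. b' \<in> ?B' \<and> b \<in> ?B}"
    by (auto simp: coh_map_def coh_class_def r_coset_def set_mult_def monoid_vec_simps)
  also have "\<dots> = {b' + \<phi> v |b'. b' \<in> ?B'}"
  proof (intro equalityI subsetI)
    fix x assume "x \<in> {b' + \<phi> (b + v) |b' b. b' \<in> ?B' \<and> b \<in> ?B}"
    then obtain b b' where b: "b \<in> ?B" "b' \<in> ?B'" "x = b' + \<phi> (b + v)" by blast
    have "x = (b' + \<phi> b) + \<phi> v"
      unfolding b(3) add[OF b(1)]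
      by (rule assoc_add_vec[symmetric]) (use B'c b B[OF b(1)] \<phi>v in blast)+
    moreover have "b' + \<phi> b \<in> ?B'"
      using subgroup.m_closed[OF S b(2) B[OF b(1)]] by (simp add: monoid_vec_simps)
    ultimately show "x \<in> {b' + \<phi> v |b'. b' \<in> ?B'}" by blast
  next
    fix x assume "x \<in> {b' + \<phi> v |b'. b' \<in> ?B'}"
    then obtain b' where b: "b' \<in> ?B'" "x = b' + \<phi> v" by blast
    moreover have "0\<^sub>v (rank X) + v = v" using v by simp
    ultimately show "x \<in> {b' + \<phi> (b + v) |b' b. b' \<in> ?B' \<and> b \<in> ?B}" using 0 by force
  qed
  also have "\<dots> = coh_class G Y i q (\<phi> v)"
    by (auto simp: coh_class_def r_coset_def monoid_vec_simps)
  finally show ?thesis .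
qed

lemma chain_map_cocycle:
  assumes X: "is_cplx G X" and Y: "is_cplx G Y" and M: "chain_map G X Y M" and v: "v \<in> cocycles G X i q"
  shows "M *\<^sub>v v \<in> cocycles G Y i q"
proof -
  have "chain_map G (rank_one (i, q)) Y (M * col_mat v)"
    by (rule chain_map_comp[OF _ M is_cplx_rank_one X Y]) (use v in \<open>simp_all add: chain_map_rank_one_iff[OF X]\<close>)
  then show ?thesis
    by (simp add: mult_col_mat[OF chain_map_carrier[OF M] cocycles_carrier[OF v]] chain_map_rank_one_iff[OF Y])
qed

lemma chain_map_coboundary:
  assumes X: "is_cplx G X" and Y: "is_cplx G Y" and M: "chain_map G X Y M" and v: "v \<in> coboundaries G X i q"
  shows "M *\<^sub>v v \<in> coboundaries G Y i q"
proof -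
  note c = is_cplx_carrier[OF X] is_cplx_carrier[OF Y] chain_map_carrier[OF M]
  obtain x where x: "x \<in> cochains G X (i - 1) q" "v = diff X *\<^sub>v x"
    using v unfolding coboundaries_def by blast
  note xc = cochains_carrier[OF x(1)]
  have "hom_map G (0, 0) (rank_one (i - 1, q)) Y (M * col_mat x)"
    by (rule hom_map_mult[of 0 0 _ X]) (use x(1) M in \<open>simp_all add: hom_map_rank_one_iff chain_map_def\<close>)
  then have Mx: "M *\<^sub>v x \<in> cochains G Y (i - 1) q"
    by (simp add: mult_col_mat[OF c(3) xc] hom_map_rank_one_iff)
  have "M *\<^sub>v v = (M * diff X) *\<^sub>v x" unfolding x(2) using c xc by simp
  also have "M * diff X = diff Y * M" using M by (simp add: chain_map_def)
  also have "(diff Y * M) *\<^sub>v x = diff Y *\<^sub>v (M *\<^sub>v x)" using c xc by simp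
  finally show ?thesis unfolding coboundaries_def using Mx by blast
qed

end

context graded_hom
begin

text \<open>The degree condition on cochains is again that of homogeneous maps out of a module of rank one.\<close>

lemma cochains_base_change:
  assumes "v \<in> cochains G X i q"
  shows "map_vec hom v \<in> cochains G' (bc X) i q"
proof -
  have "hom_map G (0, 0) (rank_one (i, q)) X (col_mat v)"
    using assms by (simp add: hom_map_rank_one_iff)
  then have "hom_map G' (0, 0) (bc (rank_one (i, q))) (bc X) (col_mat (map_vec hom v))"
    using hom_map_base_change by (metis map_col_mat)
  moreover have "bc (rank_one (i, q)) = rank_one (i, q)"
    by (simp add: base_change_def rank_one_def) (intro eq_matI, simp_all)
  ultimately show ?thesis by (simp add: hom_map_rank_one_iff)
qed

lemma cocycles_base_change:
  assumes X: "is_cplx G X" and v: "v \<in> cocycles G X i q"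
  shows "map_vec hom v \<in> cocycles G' (bc X) i q"
proof -
  have "map_mat hom (diff X) *\<^sub>v map_vec hom v = map_vec hom (diff X *\<^sub>v v)"
    using mult_mat_vec_hom[OF is_cplx_carrier[OF X] cocycles_carrier[OF v]] by simp
  also have "\<dots> = 0\<^sub>v (rank X)" using v by (simp add: cocycles_def vec_hom_zero)
  finally show ?thesis
    using cochains_base_change[of v X i q] v by (simp add: cocycles_def base_change_def)
qed

lemma coboundaries_base_change:
  assumes X: "is_cplx G X" and v: "v \<in> coboundaries G X i q"
  shows "map_vec hom v \<in> coboundaries G' (bc X) i q"
proof -
  obtain x where x: "x \<in> cochains G X (i - 1) q" "v = diff X *\<^sub>v x"
    using v unfolding coboundaries_def by blast
  have "map_vec hom v = diff (bc X) *\<^sub>v map_vec hom x"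
    unfolding x(2) using mult_mat_vec_hom[OF is_cplx_carrier[OF X] cochains_carrier[OF x(1)]]
    by (simp add: base_change_def)
  then show ?thesis unfolding coboundaries_def using cochains_base_change[OF x(1)] by blast
qed

lemma map_vec_add: "v \<in> carrier_vec n \<Longrightarrow> w \<in> carrier_vec n \<Longrightarrow>
    map_vec hom (v + w) = map_vec hom v + map_vec hom w"
  by (intro eq_vecI) (simp_all add: hom_add)

end

section \<open>Local maps of triples\<close>

lemma (in graded_hom) base_change_rank_one: "bc (rank_one ab) = rank_one ab"
  by (simp add: base_change_def rank_one_def) (intro eq_matI, simp_all)

lemma rank_mod_loc [simp]:
  "rank (C_mod T) = rank (Cpart T)" "rank (D_mod r T) = rank (Dpart T)" "rank (D_loc T) = rank (Dpart T)"
  by (simp_all add: C_mod_def D_mod_def D_loc_def)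

text \<open>The map \<open>r\<close> is the reduction of the ground ring modulo 2.  Both kinds of triples are treated at
once; the cases \<open>mod2_int\<close> and \<open>mod2_bit\<close> are separated only when units of the ground ring
have to be identified.\<close>

locale reduction = comm_ring_hom r for r :: "'k::comm_ring_1 \<Rightarrow> bit"
begin

sublocale red: graded_hom "red_S r" poly_gr ground_gr
  by (rule graded_hom_red_S) unfold_locales

lemma leo_triple_cplx:
  assumes "leo_triple r T"
  shows "is_cplx ground_gr (Cpart T)" "is_cplx poly_gr (Dpart T)" "is_cplx ground_gr (C_mod T)"
    "is_cplx ground_gr (D_mod r T)" "is_cplx laurent_gr (D_loc T)"
    "chain_map ground_gr (C_mod T) (D_mod r T) (fpart T)"
proof -
  show C: "is_cplx ground_gr (Cpart T)" and D: "is_cplx poly_gr (Dpart T)"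
    and "chain_map ground_gr (C_mod T) (D_mod r T) (fpart T)"
    using assms by (simp_all add: leo_triple_def homotopy_equiv_def)
  show "is_cplx ground_gr (C_mod T)" unfolding C_mod_def by (rule mod2.is_cplx_base_change[OF C])
  show "is_cplx ground_gr (D_mod r T)" unfolding D_mod_def by (rule red.is_cplx_base_change[OF D])
  show "is_cplx laurent_gr (D_loc T)" unfolding D_loc_def by (rule loc.is_cplx_base_change[OF D])
qed

lemma local_map_id:
  assumes T: "leo_triple r T"
  shows "local_map r T T (1\<^sub>m (rank (Cpart T))) (1\<^sub>m (rank (Dpart T)))"
proof -
  note c = leo_triple_cplx[OF T]
  have f: "fpart T \<in> carrier_mat (rank (Dpart T)) (rank (Cpart T))"
    using chain_map_carrier[OF c(6)] by simp
  have "homotopy_equiv laurent_gr (D_loc T) (D_loc T) (1\<^sub>m (rank (D_loc T)))"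
    by (rule laurent.homotopy_equiv_id[OF c(5)])
  moreover have "homotopic ground_gr (C_mod T) (D_mod r T) (fpart T) (fpart T)"
    by (rule ground.homotopic_refl[OF c(3,4)]) (use f in simp)
  ultimately show ?thesis
    unfolding local_map_def loc.mat_hom_one of_int_hom.mat_hom_one red.mat_hom_one
    using ground.chain_map_one[OF c(1)] poly.chain_map_one[OF c(2)] f by simp
qed

text \<open>The two squares that commute up to homotopy are pasted together: with bars for reductions,
\<open>f'' \<alpha>' \<alpha> \<sim> \<beta>' f' \<alpha> \<sim> \<beta>' \<beta> f\<close>.\<close>

lemma local_map_comp:
  assumes T: "leo_triple r T" and T': "leo_triple r T'" and T'': "leo_triple r T''"
    and l: "local_map r T T' \<alpha> \<beta>" and l': "local_map r T' T'' \<alpha>' \<beta>'"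
  shows "local_map r T T'' (\<alpha>' * \<alpha>) (\<beta>' * \<beta>)"
proof -
  note c = leo_triple_cplx[OF T] and c' = leo_triple_cplx[OF T'] and c'' = leo_triple_cplx[OF T'']
  let ?A = "map_mat of_int \<alpha> :: bit mat" and ?A' = "map_mat of_int \<alpha>' :: bit mat"
  let ?B = "map_mat (red_S r) \<beta>" and ?B' = "map_mat (red_S r) \<beta>'"
  have a: "chain_map ground_gr (Cpart T) (Cpart T') \<alpha>" "chain_map ground_gr (Cpart T') (Cpart T'') \<alpha>'"
    and b: "chain_map poly_gr (Dpart T) (Dpart T') \<beta>" "chain_map poly_gr (Dpart T') (Dpart T'') \<beta>'"
    and h: "homotopic ground_gr (C_mod T) (D_mod r T') (fpart T' * ?A) (?B * fpart T)"
      "homotopic ground_gr (C_mod T') (D_mod r T'') (fpart T'' * ?A') (?B' * fpart T')"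
    and e: "homotopy_equiv laurent_gr (D_loc T) (D_loc T') (map_mat to_laurent \<beta>)"
      "homotopy_equiv laurent_gr (D_loc T') (D_loc T'') (map_mat to_laurent \<beta>')"
    using l l' unfolding local_map_def by blast+
  note car = chain_map_carrier[OF a(1)] chain_map_carrier[OF a(2)] chain_map_carrier[OF b(1)]
    chain_map_carrier[OF b(2)]
  note fcar = chain_map_carrier[OF c(6), unfolded rank_mod_loc] chain_map_carrier[OF c'(6), unfolded rank_mod_loc]
    chain_map_carrier[OF c''(6), unfolded rank_mod_loc]
  have A: "chain_map ground_gr (C_mod T) (C_mod T') ?A"
    unfolding C_mod_def by (rule mod2.chain_map_base_change[OF c(1) c'(1) a(1)])
  have B': "chain_map ground_gr (D_mod r T') (D_mod r T'') ?B'"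
    unfolding D_mod_def by (rule red.chain_map_base_change[OF c'(2) c''(2) b(2)])
  have Ac: "?A \<in> carrier_mat (rank (Cpart T')) (rank (Cpart T))"
    "?A' \<in> carrier_mat (rank (Cpart T'')) (rank (Cpart T'))"
    "?B \<in> carrier_mat (rank (Dpart T')) (rank (Dpart T))"
    "?B' \<in> carrier_mat (rank (Dpart T'')) (rank (Dpart T'))"
    using car by simp_all
  have 1: "homotopic ground_gr (C_mod T) (D_mod r T'') ((fpart T'' * ?A') * ?A) ((?B' * fpart T') * ?A)"
    by (rule ground.homotopic_comp_right[OF c'(3) c''(4) c(3) A h(2)]) (use Ac fcar in simp_all)
  have 2: "homotopic ground_gr (C_mod T) (D_mod r T'') (?B' * (fpart T' * ?A)) (?B' * (?B * fpart T))"
    by (rule ground.homotopic_comp_left[OF c(3) c'(4) c''(4) B' h(1)]) (use Ac fcar in simp_all)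
  have "homotopic ground_gr (C_mod T) (D_mod r T'') (fpart T'' * (?A' * ?A)) ((?B' * ?B) * fpart T)"
    using ground.homotopic_trans[OF c(3) c''(4) 1[unfolded assoc_mult_mat[OF Ac(4) fcar(2) Ac(1)]] 2]
      Ac fcar by simp
  then show ?thesis
    unfolding local_map_def loc.mat_hom_mult[OF car(4,3)] of_int_hom.mat_hom_mult[OF car(2,1)]
      red.mat_hom_mult[OF car(4,3)]
    using ground.chain_map_comp[OF a c(1) c'(1) c''(1)] poly.chain_map_comp[OF b c(2) c'(2) c''(2)]
      laurent.homotopy_equiv_comp[OF c(5) c'(5) c''(5) e] by blast
qed

lemma equiv_local_equiv: "equiv {T. leo_triple r T} (local_equiv r)"
proof (rule equivI)
  show "local_equiv r \<subseteq> {T. leo_triple r T} \<times> {T. leo_triple r T}"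
    unfolding local_equiv_def by blast
  show "refl_on {T. leo_triple r T} (local_equiv r)"
    unfolding local_equiv_def refl_on_def using local_map_id by blast
  show "sym (local_equiv r)"
    unfolding local_equiv_def sym_def by blast
  show "trans (local_equiv r)"
    unfolding local_equiv_def trans_def using local_map_comp by blast
qed

section \<open>Duality of local maps\<close>

lemma dual_mod_loc:
  "C_mod (dual_triple T g) = dual_cplx (C_mod T)" "D_mod r (dual_triple T g) = dual_cplx (D_mod r T)"
  "D_loc (dual_triple T g) = dual_cplx (D_loc T)"
  by (simp_all add: C_mod_def D_mod_def D_loc_def dual_triple_def base_change_dual)

lemma dual_rank_one: "dual_cplx (rank_one (a, b)) = rank_one (- a, - b)"
  by (simp add: dual_cplx_def rank_one_def)

lemma homotopy_inverse_sym:
  "chain_map G X Y f \<Longrightarrow> homotopy_inverse G X Y f g \<Longrightarrow> homotopy_inverse G Y X g f"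
  by (simp add: homotopy_inverse_def)

text \<open>The structure map of the dual is the transpose of the inverse \<open>g\<close> of \<open>f\<close>, so that it again goes from
the first part to the second; the localized part is dual to a free module generated in degree
\<open>(0, q)\<close>, hence equivalent to one generated in degree \<open>(0, -q)\<close>.\<close>

lemma leo_triple_dual:
  assumes T: "leo_triple r T" and g: "leo_homotopy_inverse r T g"
  shows "leo_triple r (dual_triple T g)"
proof -
  note c = leo_triple_cplx[OF T]
  have g': "homotopy_inverse ground_gr (C_mod T) (D_mod r T) (fpart T) g"
    using g by (simp add: leo_homotopy_inverse_def)
  have gc: "chain_map ground_gr (D_mod r T) (C_mod T) g"
    using g' by (simp add: homotopy_inverse_def)
  have 1: "homotopy_equiv ground_gr (dual_cplx (C_mod T)) (dual_cplx (D_mod r T)) (transpose_mat g)"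
    by (rule homotopy_equiv_dual[OF gc homotopy_inverse_sym[OF c(6) g'] c(4,3)])
  obtain q p where q: "even q" and p: "homotopy_equiv laurent_gr (D_loc T) (rank_one (0, q)) p"
    using T unfolding leo_triple_def by blast
  obtain s where pc: "chain_map laurent_gr (D_loc T) (rank_one (0, q)) p"
    and s: "homotopy_inverse laurent_gr (D_loc T) (rank_one (0, q)) p s"
    using p unfolding homotopy_equiv_def by blast
  have sc: "chain_map laurent_gr (rank_one (0, q)) (D_loc T) s"
    using s by (simp add: homotopy_inverse_def)
  have "homotopy_equiv laurent_gr (dual_cplx (D_loc T)) (dual_cplx (rank_one (0, q))) (transpose_mat s)"
    by (rule homotopy_equiv_dual[OF sc homotopy_inverse_sym[OF pc s] is_cplx_rank_one c(5)]) simp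
  then have "homotopy_equiv laurent_gr (dual_cplx (D_loc T)) (rank_one (0, - q)) (transpose_mat s)"
    by (simp add: dual_rank_one)
  moreover have "even (- q)" using q by simp
  ultimately show ?thesis
    unfolding leo_triple_def dual_mod_loc
    using 1 is_cplx_dual[OF c(1)] is_cplx_dual[OF c(2)]
    unfolding dual_triple_def leo.simps by blast
qed

text \<open>The homotopy \<open>f' \<alpha> \<sim> \<beta> f\<close> between maps from \<open>C\<close> to \<open>D'\<close> is first turned into one between maps from
\<open>D\<close> to \<open>C'\<close> by composing with the inverses on both sides,
\<open>\<alpha> g \<sim> g' f' \<alpha> g \<sim> g' \<beta> f g \<sim> g' \<beta>\<close>, and its transpose is the condition required of the dual
maps.\<close>

lemma local_map_dual:
  assumes T: "leo_triple r T" and T': "leo_triple r T'"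
    and g: "leo_homotopy_inverse r T g" and g': "leo_homotopy_inverse r T' g'"
    and l: "local_map r T T' \<alpha> \<beta>"
  shows "local_map r (dual_triple T' g') (dual_triple T g) (transpose_mat \<alpha>) (transpose_mat \<beta>)"
proof -
  note c = leo_triple_cplx[OF T] and c' = leo_triple_cplx[OF T']
  let ?A = "map_mat of_int \<alpha> :: bit mat" and ?B = "map_mat (red_S r) \<beta>"
  let ?f = "fpart T" and ?f' = "fpart T'"
  have a: "chain_map ground_gr (Cpart T) (Cpart T') \<alpha>"
    and b: "chain_map poly_gr (Dpart T) (Dpart T') \<beta>"
    and h: "homotopic ground_gr (C_mod T) (D_mod r T') (?f' * ?A) (?B * ?f)"
    and e: "homotopy_equiv laurent_gr (D_loc T) (D_loc T') (map_mat to_laurent \<beta>)"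
    using l unfolding local_map_def by blast+
  have gc: "chain_map ground_gr (D_mod r T) (C_mod T) g"
    and fg: "homotopic ground_gr (D_mod r T) (D_mod r T) (?f * g) (1\<^sub>m (rank (D_mod r T)))"
    using g unfolding leo_homotopy_inverse_def homotopy_inverse_def by blast+
  have gc': "chain_map ground_gr (D_mod r T') (C_mod T') g'"
    and gf': "homotopic ground_gr (C_mod T') (C_mod T') (g' * ?f') (1\<^sub>m (rank (C_mod T')))"
    using g' unfolding leo_homotopy_inverse_def homotopy_inverse_def by blast+
  have A: "chain_map ground_gr (C_mod T) (C_mod T') ?A"
    unfolding C_mod_def by (rule mod2.chain_map_base_change[OF c(1) c'(1) a])
  have B: "chain_map ground_gr (D_mod r T) (D_mod r T') ?B"
    unfolding D_mod_def by (rule red.chain_map_base_change[OF c(2) c'(2) b])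
  have Ag: "chain_map ground_gr (D_mod r T) (C_mod T') (?A * g)"
    by (rule ground.chain_map_comp[OF gc A c(4) c(3) c'(3)])
  have gB: "chain_map ground_gr (D_mod r T) (C_mod T') (g' * ?B)"
    by (rule ground.chain_map_comp[OF B gc' c(4) c'(4) c'(3)])
  note car = chain_map_carrier[OF A, unfolded rank_mod_loc] chain_map_carrier[OF B, unfolded rank_mod_loc]
    chain_map_carrier[OF gc, unfolded rank_mod_loc] chain_map_carrier[OF gc', unfolded rank_mod_loc]
    chain_map_carrier[OF c(6), unfolded rank_mod_loc] chain_map_carrier[OF c'(6), unfolded rank_mod_loc]
  note prods = mult_carrier_mat[OF car(1,3)] mult_carrier_mat[OF car(4,2)]
    mult_carrier_mat[OF mult_carrier_mat[OF car(4,6)] mult_carrier_mat[OF car(1,3)]]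
    mult_carrier_mat[OF mult_carrier_mat[OF car(4,2)] mult_carrier_mat[OF car(5,3)]]
  have "homotopic ground_gr (D_mod r T) (C_mod T') (g' * ?f' * (?A * g)) (1\<^sub>m (rank (C_mod T')) * (?A * g))"
    by (rule ground.homotopic_comp_right[OF c'(3) c'(3) c(4) Ag gf']) (use car in simp_all)
  then have "homotopic ground_gr (D_mod r T) (C_mod T') (g' * ?f' * (?A * g)) (?A * g)"
    unfolding left_mult_one_mat[OF chain_map_carrier[OF Ag]] .
  then have 1: "homotopic ground_gr (D_mod r T) (C_mod T') (?A * g) (g' * ?f' * (?A * g))"
    by (rule ground.homotopic_sym[OF c(4) c'(3)]) (use prods in simp_all)
  have "homotopic ground_gr (D_mod r T) (D_mod r T') (?f' * ?A * g) (?B * ?f * g)"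
    by (rule ground.homotopic_comp_right[OF c(3) c'(4) c(4) gc h]) (use car in simp_all)
  then have "homotopic ground_gr (D_mod r T) (C_mod T') (g' * (?f' * ?A * g)) (g' * (?B * ?f * g))"
    by (rule ground.homotopic_comp_left[OF c(4) c'(4) c'(3) gc']) (use car in simp_all)
  moreover have "g' * (?f' * ?A * g) = g' * ?f' * (?A * g)"
    unfolding assoc_mult_mat[OF car(6,1,3)]
    by (rule assoc_mult_mat[OF car(4,6) mult_carrier_mat[OF car(1,3)], symmetric])
  moreover have "g' * (?B * ?f * g) = g' * ?B * (?f * g)"
    unfolding assoc_mult_mat[OF car(2,5,3)]
    by (rule assoc_mult_mat[OF car(4,2) mult_carrier_mat[OF car(5,3)], symmetric])
  ultimately have 2: "homotopic ground_gr (D_mod r T) (C_mod T') (g' * ?f' * (?A * g)) (g' * ?B * (?f * g))"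
    by (simp only:)
  have "homotopic ground_gr (D_mod r T) (C_mod T') (g' * ?B * (?f * g)) (g' * ?B * 1\<^sub>m (rank (D_mod r T)))"
    by (rule ground.homotopic_comp_left[OF c(4) c(4) c'(3) gB fg]) (use car in simp_all)
  then have 3: "homotopic ground_gr (D_mod r T) (C_mod T') (g' * ?B * (?f * g)) (g' * ?B)"
    unfolding right_mult_one_mat[OF chain_map_carrier[OF gB]] .
  have "homotopic ground_gr (D_mod r T) (C_mod T') (?A * g) (g' * ?B * (?f * g))"
    by (rule ground.homotopic_trans[OF c(4) c'(3) 1 2]) (use prods in simp_all)
  then have "homotopic ground_gr (D_mod r T) (C_mod T') (?A * g) (g' * ?B)"
    by (rule ground.homotopic_trans[OF c(4) c'(3) _ 3]) (use prods in simp_all)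
  then have "homotopic ground_gr (dual_cplx (C_mod T')) (dual_cplx (D_mod r T))
      (transpose_mat (?A * g)) (transpose_mat (g' * ?B))"
    by (rule homotopic_dual[OF _ c(4) c'(3)]) (use prods in simp_all)
  then have H: "homotopic ground_gr (C_mod (dual_triple T' g')) (D_mod r (dual_triple T g))
      (fpart (dual_triple T g) * map_mat of_int (transpose_mat \<alpha>))
      (map_mat (red_S r) (transpose_mat \<beta>) * fpart (dual_triple T' g'))"
    unfolding dual_mod_loc transpose_mult[OF car(1,3)] transpose_mult[OF car(4,2)]
    unfolding dual_triple_def leo.simps map_mat_transpose .
  obtain s where ec: "chain_map laurent_gr (D_loc T) (D_loc T') (map_mat to_laurent \<beta>)"
    and s: "homotopy_inverse laurent_gr (D_loc T) (D_loc T') (map_mat to_laurent \<beta>) s"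
    using e unfolding homotopy_equiv_def by blast
  have "homotopy_equiv laurent_gr (D_loc (dual_triple T' g')) (D_loc (dual_triple T g))
      (map_mat to_laurent (transpose_mat \<beta>))"
    using homotopy_equiv_dual[OF ec s c(5) c'(5)] unfolding dual_mod_loc map_mat_transpose .
  then show ?thesis
    unfolding local_map_def
    using H chain_map_dual[OF a c(1) c'(1)] chain_map_dual[OF b c(2) c'(2)]
    unfolding dual_triple_def leo.simps by blast
qed

lemma leo_homotopy_inverse_dual:
  assumes T: "leo_triple r T" and g: "leo_homotopy_inverse r T g"
  shows "leo_homotopy_inverse r (dual_triple T g) (transpose_mat (fpart T))"
proof -
  note c = leo_triple_cplx[OF T]
  have gc: "chain_map ground_gr (D_mod r T) (C_mod T) g"
    and fg: "homotopic ground_gr (D_mod r T) (D_mod r T) (fpart T * g) (1\<^sub>m (rank (D_mod r T)))"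
    and gf: "homotopic ground_gr (C_mod T) (C_mod T) (g * fpart T) (1\<^sub>m (rank (C_mod T)))"
    using g unfolding leo_homotopy_inverse_def homotopy_inverse_def by blast+
  note car = chain_map_carrier[OF gc] chain_map_carrier[OF c(6)]
  show ?thesis
    unfolding leo_homotopy_inverse_def homotopy_inverse_def dual_mod_loc
    using chain_map_dual[OF c(6) c(3,4)] homotopic_dual[OF fg c(4,4)] homotopic_dual[OF gf c(3,3)] car
    by (simp add: dual_triple_def flip: transpose_mult[OF car] transpose_mult[OF car(2,1)])
qed

lemma dual_dual_cplx: "dual_cplx (dual_cplx X) = (X :: 'r cplx)"
proof -
  have "map ((\<lambda>(a, b). (- a, - b)) \<circ> (\<lambda>(a, b). (- a, - b))) xs = xs" for xs :: "(int \<times> int) list"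
    by (induction xs) auto
  then show ?thesis by (simp add: dual_cplx_def)
qed

lemma dual_dual_triple: "dual_triple (dual_triple T g) (transpose_mat (fpart T)) = T"
  by (simp add: dual_triple_def dual_dual_cplx)

end

section \<open>The triples of rank one and full gradings\<close>

text \<open>Local maps out of these triples play the role of pairs of compatible cohomology classes.\<close>

definition shifted_unit :: "int \<Rightarrow> 'k::comm_ring_1 leo" where
  "shifted_unit q = \<lparr>Cpart = rank_one (0, q), Dpart = rank_one (0, q), fpart = 1\<^sub>m 1\<rparr>"

lemma shifted_unit_0: "shifted_unit 0 = unit_triple"
  by (simp add: shifted_unit_def unit_triple_def)

text \<open>A common form of complete and odd reduced fullness that can be composed with local maps; it is
compared with the definitions by cohomology classes in \<open>completely_reduced_full_eq\<close> and
\<open>oddly_reduced_full_eq\<close>.\<close>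

definition locally_full :: "('k::comm_ring_1 \<Rightarrow> bit) \<Rightarrow> 'k leo \<Rightarrow> int \<Rightarrow> bool" where
  "locally_full r T q \<longleftrightarrow> even q \<and> (\<exists>\<alpha> \<beta>. local_map r (shifted_unit q) T \<alpha> \<beta>)"

text \<open>A homotopy is composed with a differential on either side, so it contributes nothing when both
differentials vanish.  This turns statements up to homotopy about modules of rank one into
equations in the coefficient ring.\<close>

lemma homotopic_zero_diff:
  assumes H: "homotopic G X Y M N"
    and M: "M \<in> carrier_mat (rank Y) (rank X)" and N: "N \<in> carrier_mat (rank Y) (rank X)"
    and dX: "diff X = 0\<^sub>m (rank X) (rank X)" and dY: "diff Y = 0\<^sub>m (rank Y) (rank Y)"
  shows "M = N"
proof -
  obtain K where K: "hom_map G (-1, 0) X Y K" and eq: "M - N = diff Y * K + K * diff X"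
    using H unfolding homotopic_def by blast
  note Kc = hom_map_carrier[OF K]
  have MN: "M - N = 0\<^sub>m (rank Y) (rank X)"
    unfolding eq dX dY left_mult_zero_mat[OF Kc] right_mult_zero_mat[OF Kc]
    by (rule left_add_zero_mat[OF zero_carrier_mat])
  show ?thesis
  proof (rule eq_matI)
    fix i j assume ij: "i < dim_row N" "j < dim_col N"
    then have "(M - N) $$ (i, j) = 0" unfolding MN using N by simp
    then show "M $$ (i, j) = N $$ (i, j)" using ij M N by simp
  qed (use M N in simp_all)
qed

definition scalar_mat :: "'r \<Rightarrow> 'r mat" where
  "scalar_mat a = mat 1 1 (\<lambda>_. a)"

lemma scalar_mat_mult: "scalar_mat a * scalar_mat b = scalar_mat (a * b :: 'r::comm_ring_1)"
  by (rule eq_matI) (simp_all add: scalar_mat_def scalar_prod_def)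

lemma scalar_mat_1: "scalar_mat 1 = (1\<^sub>m 1 :: 'r::comm_ring_1 mat)"
  by (rule eq_matI) (simp_all add: scalar_mat_def)

lemma scalar_mat_eqD: "scalar_mat a = scalar_mat b \<Longrightarrow> a = b"
  by (drule arg_cong[of _ _ "\<lambda>M. M $$ (0, 0)"]) (simp add: scalar_mat_def)

lemma scalar_mat_eq: "M \<in> carrier_mat 1 1 \<Longrightarrow> M = scalar_mat (M $$ (0, 0))"
  by (rule eq_matI) (auto simp: scalar_mat_def)

lemma chain_map_scalar_mat:
  "a \<in> G (q - q') \<Longrightarrow> chain_map G (rank_one (i, q)) (rank_one (i, q')) (scalar_mat a)"
  by (simp add: chain_map_def hom_map_def scalar_mat_def)

context ring_grading
begin

lemma homotopy_equiv_scalar_mat: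
  assumes "a \<in> G (q - q')" "b \<in> G (q' - q)" "a * b = 1"
  shows "homotopy_equiv G (rank_one (i, q)) (rank_one (i, q')) (scalar_mat a)"
proof -
  have "homotopic G (rank_one (i, p)) (rank_one (i, p)) (1\<^sub>m 1) (1\<^sub>m 1)" for p
    by (rule homotopic_refl) (simp_all add: is_cplx_rank_one)
  then have "homotopy_inverse G (rank_one (i, q)) (rank_one (i, q')) (scalar_mat a) (scalar_mat b)"
    using assms chain_map_scalar_mat[of b G q' q i]
    by (simp add: homotopy_inverse_def scalar_mat_mult mult.commute[of b a] scalar_mat_1)
  then show ?thesis
    using chain_map_scalar_mat[of a G q q' i] assms(1) by (auto simp: homotopy_equiv_def)
qed

lemma homotopy_equiv_scalar_mat_unit:
  assumes "homotopy_equiv G (rank_one (i, q)) (rank_one (i, q')) (scalar_mat a)"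
  obtains b where "b \<in> G (q' - q)" "a * b = 1"
proof -
  obtain N where N: "homotopy_inverse G (rank_one (i, q)) (rank_one (i, q')) (scalar_mat a) N"
    using assms unfolding homotopy_equiv_def by blast
  then have h: "hom_map G (0, 0) (rank_one (i, q')) (rank_one (i, q)) N"
    by (simp add: homotopy_inverse_def chain_map_def)
  have Nc: "N \<in> carrier_mat 1 1" using hom_map_carrier[OF h] by simp
  define b where "b = N $$ (0, 0)"
  have Nb: "N = scalar_mat b" unfolding b_def by (rule scalar_mat_eq[OF Nc])
  have "b \<in> G (q' - q)" using h by (simp add: hom_map_def b_def)
  moreover have "homotopic G (rank_one (i, q')) (rank_one (i, q')) (scalar_mat (a * b)) (scalar_mat 1)"
    using N by (simp add: homotopy_inverse_def Nb scalar_mat_mult scalar_mat_1)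
  then have "scalar_mat (a * b) = scalar_mat 1"
    by (rule homotopic_zero_diff) (simp_all add: scalar_mat_def)
  then have "a * b = 1" by (rule scalar_mat_eqD)
  ultimately show thesis by (rule that)
qed

end

lemma laurent_single_mem: "k = - 2 * n \<Longrightarrow> Poly_Mapping.single n c \<in> laurent_gr k"
  by (simp add: laurent_gr_def)

text \<open>Multiplication by a power of \<open>h\<close>, which is invertible in the Laurent ring, shifts the quantum
degree by an arbitrary even number.\<close>

lemma laurent_rank_one_equiv:
  assumes "even q" "even q'"
  shows "\<exists>a. homotopy_equiv laurent_gr (rank_one (i, q)) (rank_one (i, q'))
      (scalar_mat (a :: 'k::comm_ring_1 laurent))"
proof -
  obtain n where n: "q' - q = 2 * n" using assms by (elim evenE) (metis right_diff_distrib)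
  show ?thesis
    by (rule exI, rule laurent.homotopy_equiv_scalar_mat[of "Poly_Mapping.single n 1" q q' "Poly_Mapping.single (- n) 1"])
      (use n in \<open>simp_all add: laurent_single_mem mult_single\<close>)
qed

lemma to_laurent_mem_iff: "to_laurent b \<in> laurent_gr k \<longleftrightarrow> b \<in> poly_gr k"
proof
  assume L: "to_laurent b \<in> laurent_gr k"
  show "b \<in> poly_gr k"
    unfolding poly_gr_def
  proof (intro CollectI allI impI)
    fix n assume "coeff b n \<noteq> 0"
    then have "int n \<in> Poly_Mapping.keys (to_laurent b)" by (simp add: in_keys_iff lookup_to_laurent)
    then show "k = - 2 * int n" using L unfolding laurent_gr_def by blast
  qed
qed (rule loc.hom_mem)

text \<open>Since \<open>h\<close> has degree \<open>-2\<close>, a homogeneous element of negative degree is a multiple of a positive power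
of \<open>h\<close>: it is a polynomial, and it vanishes at \<open>h = 0\<close>.\<close>

lemma laurent_gr_negative:
  assumes "a \<in> laurent_gr k" "k < 0"
  obtains b where "to_laurent b = a" "poly b 0 = 0"
proof (cases "a = 0")
  case True
  then show ?thesis using that[of 0] by (simp add: to_laurent_0)
next
  case False
  then obtain n where n: "n \<in> Poly_Mapping.keys a" by (metis keys_eq_empty ex_in_conv)
  then have k: "k = - 2 * n" using assms(1) unfolding laurent_gr_def by blast
  have keys: "m = n" if "m \<in> Poly_Mapping.keys a" for m
  proof -
    have "k = - 2 * m" using assms(1) that unfolding laurent_gr_def by blast
    then show ?thesis using k by simp
  qed
  have "n > 0" using k assms(2) by simp
  define b where "b = monom (Poly_Mapping.lookup a n) (nat n)"
  have "to_laurent b = a"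
  proof (rule poly_mapping_eqI)
    fix m
    show "Poly_Mapping.lookup (to_laurent b) m = Poly_Mapping.lookup a m"
      using keys[of m] \<open>n > 0\<close> by (cases "m = n") (auto simp: b_def to_laurent_monom lookup_single when_def in_keys_iff)
  qed
  moreover have "poly b 0 = 0" using \<open>n > 0\<close> by (simp add: b_def poly_monom zero_power)
  ultimately show ?thesis by (rule that)
qed

lemma map_mat_to_laurent_inj:
  assumes "map_mat to_laurent A = map_mat to_laurent B"
  shows "A = B"
proof (rule eq_matI)
  have d: "dim_row A = dim_row B" "dim_col A = dim_col B"
    using arg_cong[OF assms, of dim_row] arg_cong[OF assms, of dim_col] by simp_all
  then show "dim_row A = dim_row B" "dim_col A = dim_col B" by simp_all
  fix i j assume ij: "i < dim_row B" "j < dim_col B"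
  have "to_laurent (A $$ (i, j)) = to_laurent (B $$ (i, j))"
    using arg_cong[OF assms, of "\<lambda>M. M $$ (i, j)"] ij d by simp
  then show "A $$ (i, j) = B $$ (i, j)" by (rule to_laurent_inj)
qed

context reduction
begin

lemma shifted_unit_simps:
  "Cpart (shifted_unit q) = rank_one (0, q)" "Dpart (shifted_unit q) = rank_one (0, q)"
  "fpart (shifted_unit q) = 1\<^sub>m 1" "C_mod (shifted_unit q) = rank_one (0, q)"
  "D_mod r (shifted_unit q) = rank_one (0, q)" "D_loc (shifted_unit q) = rank_one (0, q)"
  by (simp_all add: shifted_unit_def C_mod_def D_mod_def D_loc_def
      mod2.base_change_rank_one red.base_change_rank_one loc.base_change_rank_one)

lemma leo_triple_shifted_unit: "even q \<Longrightarrow> leo_triple r (shifted_unit q)"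
  unfolding leo_triple_def shifted_unit_simps
  using ground.homotopy_equiv_id[of "rank_one (0, q)"] laurent.homotopy_equiv_id[of "rank_one (0, q)"]
  by (auto simp: is_cplx_rank_one)

text \<open>A witness of fullness is a local map into \<open>T\<close>, which can be composed with the given one.\<close>

lemma locally_full_local_map:
  assumes "leo_triple r T" "leo_triple r T'" "local_map r T T' \<alpha> \<beta>" "locally_full r T q"
  shows "locally_full r T' q"
  using assms local_map_comp[OF leo_triple_shifted_unit] unfolding locally_full_def by blast

text \<open>Polynomials have degree at most 0, so if \<open>q\<close> exceeded the quantum degrees of all generators of \<open>D\<close>,
the map from the unit shifted to \<open>q\<close> would vanish on the second part; but the zero map is not an
equivalence after localization.\<close>

lemma locally_full_le:
  assumes T: "leo_triple r T" and full: "locally_full r T q"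
  obtains i where "i < rank (Dpart T)" "q \<le> qdeg (Dpart T) i"
proof -
  obtain \<alpha> \<beta> where l: "local_map r (shifted_unit q) T \<alpha> \<beta>"
    using full unfolding locally_full_def by blast
  then have \<beta>: "hom_map poly_gr (0, 0) (rank_one (0, q)) (Dpart T) \<beta>"
    and e: "homotopy_equiv laurent_gr (rank_one (0, q)) (D_loc T) (map_mat to_laurent \<beta>)"
    unfolding local_map_def shifted_unit_simps chain_map_def by blast+
  have \<beta>c: "\<beta> \<in> carrier_mat (rank (Dpart T)) 1" using hom_map_carrier[OF \<beta>] by simp
  have "\<exists>i<rank (Dpart T). q \<le> qdeg (Dpart T) i"
  proof (rule ccontr)
    assume neg: "\<not> (\<exists>i<rank (Dpart T). q \<le> qdeg (Dpart T) i)"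
    have "\<beta> = 0\<^sub>m (rank (Dpart T)) 1"
    proof (rule eq_matI)
      fix i j assume "i < dim_row (0\<^sub>m (rank (Dpart T)) 1 :: 'k poly mat)" "j < dim_col (0\<^sub>m (rank (Dpart T)) 1 :: 'k poly mat)"
      then have i: "i < rank (Dpart T)" and j: "j = 0" by simp_all
      then have "\<beta> $$ (i, 0) \<in> (if hdeg (Dpart T) i = 0 then poly_gr (q - qdeg (Dpart T) i) else {0})"
        using \<beta> by (simp add: hom_map_def cong: if_cong)
      moreover have "p = 0" if "p \<in> poly_gr (q - qdeg (Dpart T) i)" for p :: "'k poly"
      proof (rule poly_eqI, rule ccontr)
        fix n assume "coeff p n \<noteq> coeff 0 n"
        then have "q - qdeg (Dpart T) i = - 2 * int n" using that unfolding poly_gr_def by simp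
        then show False using neg i by force
      qed
      ultimately show "\<beta> $$ (i, j) = 0\<^sub>m (rank (Dpart T)) 1 $$ (i, j)"
        using i j by (auto split: if_splits)
    qed (use \<beta>c in simp_all)
    then have z: "map_mat to_laurent \<beta> = 0\<^sub>m (rank (Dpart T)) 1"
      by (intro eq_matI) (simp_all add: to_laurent_0)
    obtain N where N: "homotopy_inverse laurent_gr (rank_one (0, q)) (D_loc T) (map_mat to_laurent \<beta>) N"
      using e unfolding homotopy_equiv_def by blast
    then have "chain_map laurent_gr (D_loc T) (rank_one (0, q)) N" by (simp add: homotopy_inverse_def)
    then have Nc: "N \<in> carrier_mat 1 (rank (Dpart T))" using chain_map_carrier by fastforce
    have "homotopic laurent_gr (rank_one (0, q)) (rank_one (0, q)) (N * map_mat to_laurent \<beta>) (1\<^sub>m 1)"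
      using N by (simp add: homotopy_inverse_def)
    then have "homotopic laurent_gr (rank_one (0, q)) (rank_one (0, q)) (0\<^sub>m 1 1) (1\<^sub>m 1 :: 'k laurent mat)"
      unfolding z right_mult_zero_mat[OF Nc] .
    then have "(0\<^sub>m 1 1 :: 'k laurent mat) = 1\<^sub>m 1"
      by (rule homotopic_zero_diff) simp_all
    then show False by (metis index_one_mat(1) index_zero_mat(1) less_numeral_extra(1) zero_neq_one)
  qed
  then show thesis using that by blast
qed

text \<open>The localized part of a triple is equivalent to the free module generated in any even
  grading, because multiplication by a power of \<open>h\<close> is invertible.\<close>

lemma D_loc_equiv_rank_one:
  assumes T: "leo_triple r T" and q: "even q"
  obtains p s where "chain_map laurent_gr (D_loc T) (rank_one (0, q)) p"
    "homotopy_inverse laurent_gr (D_loc T) (rank_one (0, q)) p s"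
proof -
  obtain q' p' where q': "even q'" and p': "homotopy_equiv laurent_gr (D_loc T) (rank_one (0, q')) p'"
    using T unfolding leo_triple_def by blast
  obtain a :: "'k laurent" where a: "homotopy_equiv laurent_gr (rank_one (0, q')) (rank_one (0, q)) (scalar_mat a)"
    using laurent_rank_one_equiv[OF q' q] by blast
  have "homotopy_equiv laurent_gr (D_loc T) (rank_one (0, q)) (scalar_mat a * p')"
    by (rule laurent.homotopy_equiv_comp[OF leo_triple_cplx(5)[OF T] _ _ p' a]) (simp_all add: is_cplx_rank_one)
  then show thesis using that unfolding homotopy_equiv_def by blast
qed

text \<open>In very low quantum degree, the generator of the localized cohomology is represented by a cocycle
with polynomial entries divisible by \<open>h\<close>.  Its reduction modulo \<open>h\<close> vanishes, so it is compatible
with the zero class in the cohomology of \<open>C\<close>.\<close>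

lemma locally_full_exists:
  assumes T: "leo_triple r T"
  shows "\<exists>q. locally_full r T q"
proof -
  note c = leo_triple_cplx[OF T]
  let ?n = "rank (Dpart T)"
  obtain b :: int where b: "\<And>i. i < ?n \<Longrightarrow> b \<le> qdeg (Dpart T) i"
  proof
    show "Min (qdeg (Dpart T) ` {..<?n}) \<le> qdeg (Dpart T) i" if "i < ?n" for i
      using that by (intro Min_le) auto
  qed
  \<comment> \<open>An even number below the quantum degrees of all generators of \<open>D\<close>.\<close>
  define q where "q = 2 * (b div 2) - 2"
  have q: "even q" and qb: "q < b" by (simp_all add: q_def)
  obtain p s where p: "chain_map laurent_gr (D_loc T) (rank_one (0, q)) p"
    and s: "homotopy_inverse laurent_gr (D_loc T) (rank_one (0, q)) p s"
    using D_loc_equiv_rank_one[OF T q] .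
  have sc: "chain_map laurent_gr (rank_one (0, q)) (D_loc T) s"
    using s by (simp add: homotopy_inverse_def)
  have se: "homotopy_equiv laurent_gr (rank_one (0, q)) (D_loc T) s"
    by (rule laurent.homotopy_inverse_equiv[OF p s])
  have scar: "s \<in> carrier_mat ?n 1" using chain_map_carrier[OF sc] by simp
  have sh: "hom_map laurent_gr (0, 0) (rank_one (0, q)) (D_loc T) s"
    using sc unfolding chain_map_def by blast
  \<comment> \<open>Below all generators every entry of \<open>s\<close> has negative degree.\<close>
  have "\<exists>b. to_laurent b = s $$ (i, 0) \<and> poly b 0 = 0" if i: "i < ?n" for i
  proof -
    have "s $$ (i, 0) \<in> (if hdeg (Dpart T) i = 0 then laurent_gr (q - qdeg (Dpart T) i) else {0})"
      using sh i by (simp add: hom_map_def D_loc_def base_change_def cong: if_cong)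
    then have "s $$ (i, 0) \<in> laurent_gr (q - qdeg (Dpart T) i)"
      by (auto split: if_splits)
    then show ?thesis
      by (rule laurent_gr_negative) (use b[OF i] qb in \<open>simp, blast\<close>)
  qed
  then obtain e where e: "\<And>i. i < ?n \<Longrightarrow> to_laurent (e i) = s $$ (i, 0)" "\<And>i. i < ?n \<Longrightarrow> poly (e i) 0 = 0"
    by metis
  define \<beta> where "\<beta> = mat ?n 1 (\<lambda>(i, j). e i)"
  have \<beta>c: "\<beta> \<in> carrier_mat ?n 1" by (simp add: \<beta>_def)
  have \<beta>s: "map_mat to_laurent \<beta> = s"
    by (rule eq_matI) (use scar e in \<open>auto simp: \<beta>_def\<close>)
  have \<beta>0: "map_mat (red_S r) \<beta> = 0\<^sub>m ?n 1"
    by (rule eq_matI) (simp_all add: \<beta>_def red_S_def e)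
  have "hom_map poly_gr (0, 0) (rank_one (0, q)) (Dpart T) \<beta>"
    unfolding hom_map_def
  proof (intro conjI allI impI)
    fix i j assume ij: "i < ?n" "j < rank (rank_one (0, q))"
    have "s $$ (i, j) \<in> (if hdeg (Dpart T) i = hdeg (rank_one (0, q)) j + fst (0, 0)
        then laurent_gr (qdeg (rank_one (0, q)) j + snd (0, 0) - qdeg (Dpart T) i) else {0})"
      using sh ij by (simp add: hom_map_def D_loc_def base_change_def cong: if_cong)
    moreover have "s $$ (i, j) = to_laurent (\<beta> $$ (i, j))"
      using ij e by (simp add: \<beta>_def)
    ultimately show "\<beta> $$ (i, j) \<in> (if hdeg (Dpart T) i = hdeg (rank_one (0, q)) j + fst (0, 0)
        then poly_gr (qdeg (rank_one (0, q)) j + snd (0, 0) - qdeg (Dpart T) i) else {0})"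
      by (metis singleton_iff to_laurent_0 to_laurent_inj to_laurent_mem_iff)
  qed (use \<beta>c in simp)
  moreover have "diff (Dpart T) * \<beta> = \<beta> * diff (rank_one (0, q))"
  proof (rule map_mat_to_laurent_inj)
    have "map_mat to_laurent (diff (Dpart T) * \<beta>) = diff (D_loc T) * s"
      unfolding loc.mat_hom_mult[OF is_cplx_carrier[OF c(2)] \<beta>c] \<beta>s by (simp add: D_loc_def base_change_def)
    also have "\<dots> = s * diff (rank_one (0, q))" using sc unfolding chain_map_def by blast
    also have "\<dots> = 0\<^sub>m ?n 1"
      using right_mult_zero_mat[OF scar] by simp
    also have "\<dots> = map_mat to_laurent (0\<^sub>m ?n 1)"
      by (rule eq_matI) (simp_all add: to_laurent_0)
    also have "0\<^sub>m ?n 1 = \<beta> * diff (rank_one (0, q))"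
      using right_mult_zero_mat[OF \<beta>c] by simp
    finally show "map_mat to_laurent (diff (Dpart T) * \<beta>) = map_mat to_laurent (\<beta> * diff (rank_one (0, q)))" .
  qed
  ultimately have \<beta>: "chain_map poly_gr (rank_one (0, q)) (Dpart T) \<beta>"
    unfolding chain_map_def by blast
  \<comment> \<open>The reduction of \<open>\<beta>\<close> is zero, so the first component may be zero as well.\<close>
  let ?\<alpha> = "0\<^sub>m (rank (Cpart T)) 1 :: int mat"
  have \<alpha>: "chain_map ground_gr (rank_one (0, q)) (Cpart T) ?\<alpha>"
    using ground.hom_map_zero[of "(0, 0)" "rank_one (0, q)" "Cpart T"]
      right_mult_zero_mat[OF is_cplx_carrier[OF c(1)], of 1] by (simp add: chain_map_def)
  have "map_mat of_int ?\<alpha> = (0\<^sub>m (rank (Cpart T)) 1 :: bit mat)"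
    by (intro eq_matI) simp_all
  then have "fpart T * map_mat of_int ?\<alpha> = 0\<^sub>m ?n 1"
    using right_mult_zero_mat[OF chain_map_carrier[OF c(6), unfolded rank_mod_loc], of 1]
    by simp
  moreover have "map_mat (red_S r) \<beta> * 1\<^sub>m 1 = 0\<^sub>m ?n 1"
    unfolding \<beta>0 by (rule right_mult_one_mat[OF zero_carrier_mat])
  moreover have "homotopic ground_gr (rank_one (0, q)) (D_mod r T) (0\<^sub>m ?n 1) (0\<^sub>m ?n 1)"
    by (rule ground.homotopic_refl[OF is_cplx_rank_one c(4)]) simp_all
  ultimately have "local_map r (shifted_unit q) T ?\<alpha> \<beta>"
    unfolding local_map_def shifted_unit_simps \<beta>s using \<alpha> \<beta> se by simp
  then show ?thesis using q unfolding locally_full_def by blast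
qed

end

section \<open>Triviality and the extremal full grading\<close>

text \<open>The operator \<open>Greatest\<close> returns a maximum only if there is one; for integers this follows from
an element and an upper bound.\<close>

lemma Greatest_int:
  fixes P :: "int \<Rightarrow> bool"
  assumes "P k" "\<And>q. P q \<Longrightarrow> q \<le> b"
  shows "P (Greatest P)" "\<And>q. P q \<Longrightarrow> q \<le> Greatest P"
proof -
  let ?A = "{q. P q \<and> k \<le> q}"
  have fin: "finite ?A" by (rule finite_subset[of _ "{k..b}"]) (use assms(2) in auto)
  have ne: "?A \<noteq> {}" using assms(1) by blast
  have M: "P (Max ?A)" "k \<le> Max ?A" using Max_in[OF fin ne] by auto
  have "q \<le> Max ?A" if "P q" for q
    using that M(2) Max_ge[OF fin, of q] by (cases "k \<le> q") auto
  then have "Greatest P = Max ?A" "\<And>q. P q \<Longrightarrow> q \<le> Max ?A"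
    using M(1) by (auto intro!: Greatest_equality)
  then show "P (Greatest P)" "\<And>q. P q \<Longrightarrow> q \<le> Greatest P" using M(1) by simp_all
qed

context reduction
begin

lemma Greatest_locally_full:
  assumes T: "leo_triple r T"
  shows "locally_full r T (Greatest (locally_full r T))"
    and "\<And>q. locally_full r T q \<Longrightarrow> q \<le> Greatest (locally_full r T)"
proof -
  obtain k where k: "locally_full r T k" using locally_full_exists[OF T] by blast
  have b: "q \<le> Max (qdeg (Dpart T) ` {..<rank (Dpart T)})" if full: "locally_full r T q" for q
  proof -
    obtain i where "i < rank (Dpart T)" "q \<le> qdeg (Dpart T) i" using locally_full_le[OF T full] .
    moreover from this have "qdeg (Dpart T) i \<le> Max (qdeg (Dpart T) ` {..<rank (Dpart T)})"
      by (intro Max_ge) auto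
    ultimately show ?thesis by linarith
  qed
  show "locally_full r T (Greatest (locally_full r T))" by (rule Greatest_int(1)[of "locally_full r T", OF k b])
  show "q \<le> Greatest (locally_full r T)" if "locally_full r T q" for q
    by (rule Greatest_int(2)[of "locally_full r T", OF k b that])
qed

lemma leo_triple_unit: "leo_triple r unit_triple"
  using leo_triple_shifted_unit[of 0] by (simp add: shifted_unit_0)

lemma trivial_triple_iff_local_maps:
  assumes T: "leo_triple r T"
  shows "trivial_triple r T \<longleftrightarrow>
    (\<exists>\<alpha> \<beta>. local_map r T unit_triple \<alpha> \<beta>) \<and> (\<exists>\<alpha> \<beta>. local_map r unit_triple T \<alpha> \<beta>)"
proof -
  have "trivial_triple r T \<longleftrightarrow> (T, unit_triple) \<in> local_equiv r"
    unfolding trivial_triple_def leo_group_def monoid.simps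
    using eq_equiv_class_iff[OF equiv_local_equiv] T leo_triple_unit by blast
  then show ?thesis using T leo_triple_unit by (simp add: local_equiv_def)
qed

lemma locally_full_0_iff: "locally_full r T 0 \<longleftrightarrow> (\<exists>\<alpha> \<beta>. local_map r unit_triple T \<alpha> \<beta>)"
  by (simp add: locally_full_def shifted_unit_0)

lemma locally_full_unit_le: "locally_full r unit_triple q \<Longrightarrow> q \<le> 0"
  by (rule locally_full_le[OF leo_triple_unit]) (auto simp: unit_triple_def)

lemma dual_unit_triple: "dual_triple unit_triple (1\<^sub>m 1) = unit_triple"
  by (simp add: dual_triple_def unit_triple_def dual_rank_one)

lemma leo_homotopy_inverse_unit: "leo_homotopy_inverse r unit_triple (1\<^sub>m 1)"
  unfolding leo_homotopy_inverse_def homotopy_inverse_def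
  using ground.chain_map_one[of "rank_one (0, 0)"] ground.homotopic_refl[of "rank_one (0, 0)" "rank_one (0, 0)" "1\<^sub>m 1"]
  by (simp add: shifted_unit_simps is_cplx_rank_one flip: shifted_unit_0)

text \<open>The unit triple is its own dual, and the dual of the dual triple, formed with the transpose of the
structure map as inverse, is the triple itself.\<close>

lemma local_map_to_unit_iff:
  assumes T: "leo_triple r T" and g: "leo_homotopy_inverse r T g"
  shows "(\<exists>\<alpha> \<beta>. local_map r T unit_triple \<alpha> \<beta>) \<longleftrightarrow>
    (\<exists>\<alpha> \<beta>. local_map r unit_triple (dual_triple T g) \<alpha> \<beta>)"
proof
  assume "\<exists>\<alpha> \<beta>. local_map r T unit_triple \<alpha> \<beta>"
  then show "\<exists>\<alpha> \<beta>. local_map r unit_triple (dual_triple T g) \<alpha> \<beta>"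
    using local_map_dual[OF T leo_triple_unit g leo_homotopy_inverse_unit]
    unfolding dual_unit_triple by blast
next
  assume "\<exists>\<alpha> \<beta>. local_map r unit_triple (dual_triple T g) \<alpha> \<beta>"
  then show "\<exists>\<alpha> \<beta>. local_map r T unit_triple \<alpha> \<beta>"
    using local_map_dual[OF leo_triple_unit leo_triple_dual[OF T g] leo_homotopy_inverse_unit
        leo_homotopy_inverse_dual[OF T g]]
    unfolding dual_unit_triple dual_dual_triple by blast
qed

text \<open>By \<open>local_map_to_unit_iff\<close>, the existence of local maps between \<open>T\<close> and the unit triple in both
directions says that 0 is full for \<open>T\<close> and for its dual.  Since local maps to the unit triple also
bound the full gradings by 0, this is the statement that both maxima are 0.\<close>

theorem trivial_triple_iff:
  assumes T: "leo_triple r T" and g: "leo_homotopy_inverse r T g"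
  shows "trivial_triple r T \<longleftrightarrow>
    Greatest (locally_full r T) = 0 \<and> Greatest (locally_full r (dual_triple T g)) = 0"
proof
  let ?T' = "dual_triple T g"
  have T': "leo_triple r ?T'" by (rule leo_triple_dual[OF T g])
  have g': "leo_homotopy_inverse r ?T' (transpose_mat (fpart T))"
    by (rule leo_homotopy_inverse_dual[OF T g])
  { assume "trivial_triple r T"
    then have to: "\<exists>\<alpha> \<beta>. local_map r T unit_triple \<alpha> \<beta>" and from_unit: "\<exists>\<alpha> \<beta>. local_map r unit_triple T \<alpha> \<beta>"
      using trivial_triple_iff_local_maps[OF T] by simp_all
    have "Greatest (locally_full r U) = 0"
      if U: "leo_triple r U" and 1: "\<exists>\<alpha> \<beta>. local_map r U unit_triple \<alpha> \<beta>"
        and 2: "\<exists>\<alpha> \<beta>. local_map r unit_triple U \<alpha> \<beta>" for U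
    proof (rule Greatest_equality)
      show "locally_full r U 0" using 2 by (simp add: locally_full_0_iff)
      show "q \<le> 0" if "locally_full r U q" for q
        using 1 locally_full_local_map[OF U leo_triple_unit _ that] locally_full_unit_le by blast
    qed
    moreover have "\<exists>\<alpha> \<beta>. local_map r ?T' unit_triple \<alpha> \<beta>"
      using local_map_to_unit_iff[OF T' g'] from_unit unfolding dual_dual_triple by blast
    moreover have "\<exists>\<alpha> \<beta>. local_map r unit_triple ?T' \<alpha> \<beta>"
      using local_map_to_unit_iff[OF T g] to by blast
    ultimately show "Greatest (locally_full r T) = 0 \<and> Greatest (locally_full r ?T') = 0"
      using T T' to from_unit by blast }
  { assume "Greatest (locally_full r T) = 0 \<and> Greatest (locally_full r ?T') = 0"
    then have "locally_full r T 0" "locally_full r ?T' 0"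
      using Greatest_locally_full(1)[OF T] Greatest_locally_full(1)[OF T'] by simp_all
    then show "trivial_triple r T"
      unfolding locally_full_0_iff trivial_triple_iff_local_maps[OF T] local_map_to_unit_iff[OF T g] by blast }
qed

end

section \<open>Coordinates of localized cohomology classes\<close>

lemma laurent_gr_0: "a \<in> laurent_gr 0 \<Longrightarrow> a = Poly_Mapping.single 0 (Poly_Mapping.lookup a 0)"
proof (rule poly_mapping_eqI)
  fix k assume a: "a \<in> laurent_gr 0"
  show "Poly_Mapping.lookup a k = Poly_Mapping.lookup (Poly_Mapping.single 0 (Poly_Mapping.lookup a 0)) k"
  proof (cases "k \<in> Poly_Mapping.keys a")
    case True
    then have "0 = - 2 * k" using a unfolding laurent_gr_def by blast
    then show ?thesis by simp
  next
    case False
    then show ?thesis by (auto simp: in_keys_iff lookup_single when_def)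
  qed
qed

lemma single_eq_iff: "Poly_Mapping.single k a = Poly_Mapping.single k b \<longleftrightarrow> a = b"
proof
  assume "Poly_Mapping.single k a = Poly_Mapping.single k b"
  then have "Poly_Mapping.lookup (Poly_Mapping.single k a) k = Poly_Mapping.lookup (Poly_Mapping.single k b) k"
    by (rule arg_cong)
  then show "a = b" by (simp only: lookup_single_eq)
qed simp

context reduction
begin

text \<open>An equivalence \<open>p\<close> from the localized part to a free module generated in degree \<open>(0, q)\<close> sends a
cocycle of that degree to an element of degree 0 of the Laurent ring, that is, to an element \<open>\<chi> v\<close> of
the ground ring.  The coordinate is additive, detects coboundaries and takes the value 1 because
\<open>p\<close> has a homotopy inverse \<open>s\<close>.  Since \<open>s\<close> recovers a cocycle from its coordinate up to
homotopy, the map given by \<open>v\<close> is an equivalence if and only if multiplication by \<open>\<chi> v\<close> is.\<close>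

lemma localized_class_coordinate:
  assumes T: "leo_triple r T" and q: "even q"
  obtains \<chi> :: "'k laurent vec \<Rightarrow> 'k" and e where
    "e \<in> cocycles laurent_gr (D_loc T) 0 q" "\<chi> e = 1"
    "\<And>v w. v \<in> cocycles laurent_gr (D_loc T) 0 q \<Longrightarrow> w \<in> cocycles laurent_gr (D_loc T) 0 q \<Longrightarrow>
      \<chi> (v + w) = \<chi> v + \<chi> w"
    "\<And>v. v \<in> cocycles laurent_gr (D_loc T) 0 q \<Longrightarrow> \<chi> v = 0 \<longleftrightarrow> v \<in> coboundaries laurent_gr (D_loc T) 0 q"
    "\<And>v. v \<in> cocycles laurent_gr (D_loc T) 0 q \<Longrightarrow>
      \<chi> v dvd 1 \<longleftrightarrow> homotopy_equiv laurent_gr (rank_one (0, q)) (D_loc T) (col_mat v)"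
proof -
  let ?X = "D_loc T" and ?R = "rank_one (0, q) :: 'k laurent cplx"
  let ?Z = "cocycles laurent_gr ?X 0 q" and ?B = "coboundaries laurent_gr ?X 0 q"
  have X: "is_cplx laurent_gr ?X" by (rule leo_triple_cplx(5)[OF T])
  have R: "is_cplx laurent_gr ?R" by (simp add: is_cplx_rank_one)
  obtain p s where p: "chain_map laurent_gr ?X ?R p" and s: "homotopy_inverse laurent_gr ?X ?R p s"
    using D_loc_equiv_rank_one[OF T q] .
  have sc: "chain_map laurent_gr ?R ?X s"
    and sp: "homotopic laurent_gr ?X ?X (s * p) (1\<^sub>m (rank ?X))"
    and ps: "homotopic laurent_gr ?R ?R (p * s) (1\<^sub>m (rank ?R))"
    using s unfolding homotopy_inverse_def by blast+
  have se: "homotopy_equiv laurent_gr ?R ?X s" by (rule laurent.homotopy_inverse_equiv[OF p s])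
  have pe: "homotopy_equiv laurent_gr ?X ?R p" using p s unfolding homotopy_equiv_def by blast
  have pcar: "p \<in> carrier_mat 1 (rank ?X)" using chain_map_carrier[OF p] by simp
  have scar: "s \<in> carrier_mat (rank ?X) 1" using chain_map_carrier[OF sc] by simp
  note Zc = cocycles_carrier[of _ laurent_gr ?X 0 q]
  define \<chi> where "\<chi> v = Poly_Mapping.lookup ((p *\<^sub>v v) $ 0) 0" for v
  have coord: "p * col_mat v = scalar_mat (Poly_Mapping.single 0 (\<chi> v))" if v: "v \<in> ?Z" for v
  proof -
    have "p *\<^sub>v v \<in> cocycles laurent_gr ?R 0 q"
      by (rule laurent.chain_map_cocycle[OF X R p v])
    then have "(p *\<^sub>v v) $ 0 \<in> laurent_gr 0" by (simp add: cocycles_def cochains_def)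
    then have "(p *\<^sub>v v) $ 0 = Poly_Mapping.single 0 (\<chi> v)" unfolding \<chi>_def by (rule laurent_gr_0)
    moreover have "col_mat (p *\<^sub>v v) = scalar_mat ((p *\<^sub>v v) $ 0)"
      using pcar by (intro eq_matI) (auto simp: scalar_mat_def col_mat_def)
    ultimately show ?thesis by (simp add: mult_col_mat[OF pcar Zc[OF v]])
  qed
  define e where "e = col s 0"
  have se_col: "s = col_mat e" unfolding e_def by (rule one_column_mat[OF scar])
  have e: "e \<in> ?Z" using sc by (simp add: se_col chain_map_rank_one_iff[OF X])
  have "p * s = 1\<^sub>m (rank ?R)"
    by (rule homotopic_zero_diff[OF ps]) (use pcar scar in simp_all)
  then have "scalar_mat (Poly_Mapping.single 0 (\<chi> e)) = scalar_mat (1 :: 'k laurent)"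
    unfolding coord[OF e, folded se_col, symmetric] scalar_mat_1 by simp
  then have "Poly_Mapping.single 0 (\<chi> e) = (1 :: 'k laurent)" by (rule scalar_mat_eqD)
  then have \<chi>e: "\<chi> e = 1" by (metis single_one single_eq_iff)
  have add: "\<chi> (v + w) = \<chi> v + \<chi> w" if "v \<in> ?Z" "w \<in> ?Z" for v w
  proof -
    have "p *\<^sub>v (v + w) = p *\<^sub>v v + p *\<^sub>v w"
      by (rule mult_add_distrib_mat_vec[OF pcar Zc[OF that(1)] Zc[OF that(2)]])
    then show ?thesis using pcar by (simp add: \<chi>_def lookup_add)
  qed
  have htp: "homotopic laurent_gr ?R ?X (s * (p * col_mat v)) (col_mat v)" if v: "v \<in> ?Z" for v
  proof -
    have vc: "col_mat v \<in> carrier_mat (rank ?X) 1" by (rule col_mat_carrier[OF Zc[OF v]])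
    have "homotopic laurent_gr ?R ?X (s * p * col_mat v) (1\<^sub>m (rank ?X) * col_mat v)"
      by (rule laurent.homotopic_comp_right[OF X X R _ sp])
        (use v mult_carrier_mat[OF scar pcar] in \<open>simp_all add: chain_map_rank_one_iff[OF X]\<close>)
    then show ?thesis
      unfolding assoc_mult_mat[OF scar pcar vc] left_mult_one_mat[OF vc] .
  qed
  have ker: "\<chi> v = 0 \<longleftrightarrow> v \<in> ?B" if v: "v \<in> ?Z" for v
  proof
    assume "\<chi> v = 0"
    then have "p * col_mat v = 0\<^sub>m 1 1"
      using coord[OF v] by (auto simp: scalar_mat_def)
    then have "s * (p * col_mat v) = 0\<^sub>m (rank ?X) 1"
      using right_mult_zero_mat[OF scar, of 1] by simp
    also have "\<dots> = col_mat (0\<^sub>v (rank ?X))"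
      by (rule eq_matI) (auto simp: col_mat_def)
    finally have "0\<^sub>v (rank ?X) - v \<in> ?B"
      using htp[OF v] homotopic_rank_one_iff[OF X zero_carrier_vec Zc[OF v]] by simp
    moreover have "v = - (0\<^sub>v (rank ?X) - v)" using Zc[OF v] by (intro eq_vecI) simp_all
    ultimately show "v \<in> ?B"
      using subgroup.m_inv_closed[OF laurent.subgroup_coboundaries[OF X]]
        inv_monoid_vec[of "0\<^sub>v (rank ?X) - v" "rank ?X"] Zc[OF v] by (metis minus_carrier_vec zero_carrier_vec)
  next
    assume "v \<in> ?B"
    then have "p *\<^sub>v v \<in> coboundaries laurent_gr ?R 0 q"
      by (rule laurent.chain_map_coboundary[OF X R p])
    then obtain w where w: "w \<in> carrier_vec 1" "p *\<^sub>v v = 0\<^sub>m 1 1 *\<^sub>v w"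
      unfolding coboundaries_def using cochains_carrier by fastforce
    then have "p *\<^sub>v v = 0\<^sub>v 1" using mult_zero_mat_vec[OF w(1)] by simp
    then show "\<chi> v = 0" by (simp add: \<chi>_def)
  qed
  have equiv: "\<chi> v dvd 1 \<longleftrightarrow> homotopy_equiv laurent_gr ?R ?X (col_mat v)" if v: "v \<in> ?Z" for v
  proof
    have vm: "chain_map laurent_gr ?R ?X (col_mat v)" using v by (simp add: chain_map_rank_one_iff[OF X])
    { assume "\<chi> v dvd 1"
      then obtain c where c: "1 = \<chi> v * c" by (elim dvdE)
      have "homotopy_equiv laurent_gr ?R ?R (p * col_mat v)"
        unfolding coord[OF v]
        by (rule laurent.homotopy_equiv_scalar_mat[where b = "Poly_Mapping.single 0 c"])
          (simp_all add: laurent_single_mem mult_single flip: c)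
      then have "homotopy_equiv laurent_gr ?R ?X (s * (p * col_mat v))"
        by (rule laurent.homotopy_equiv_comp[OF R R X _ se])
      then show "homotopy_equiv laurent_gr ?R ?X (col_mat v)"
        by (rule laurent.homotopy_equiv_cong[OF R X _ vm htp[OF v]]) }
    { assume "homotopy_equiv laurent_gr ?R ?X (col_mat v)"
      then have "homotopy_equiv laurent_gr ?R ?R (p * col_mat v)"
        by (rule laurent.homotopy_equiv_comp[OF R X R _ pe])
      then obtain b where b: "b \<in> laurent_gr (q - q)" "Poly_Mapping.single 0 (\<chi> v) * b = 1"
        unfolding coord[OF v] by (rule laurent.homotopy_equiv_scalar_mat_unit)
      then obtain c where "b = Poly_Mapping.single 0 c" using laurent_gr_0[of b] by auto
      then have "Poly_Mapping.single (0::int) (\<chi> v * c) = Poly_Mapping.single 0 1"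
        using b(2) by (simp add: mult_single)
      then have "\<chi> v * c = 1" by (simp only: single_eq_iff)
      then show "\<chi> v dvd 1" by (metis dvd_triv_left) }
  qed
  show thesis by (rule that[OF e \<chi>e add ker equiv])
qed

section \<open>Fullness in terms of cohomology classes\<close>

text \<open>The maps in the definition of fullness, evaluated on representatives.\<close>

lemma j_map_class:
  assumes T: "leo_triple r T" and v: "v \<in> cocycles ground_gr (Cpart T) 0 q"
  shows "j_map T q (coh_class ground_gr (Cpart T) 0 q v) = coh_class ground_gr (C_mod T) 0 q (map_vec of_int v)"
proof -
  note c = leo_triple_cplx[OF T] and vc = cocycles_carrier[OF v]
  note S = subgroup.subset[OF ground.subgroup_coboundaries[OF c(1), of 0 q], unfolded monoid_vec_simps]
  show ?thesis
    unfolding j_map_def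
  proof (rule ground.coh_map_class[OF c(3) _ _ ground.coboundaries_zero[OF c(1)] vc])
    show "map_vec of_int b \<in> coboundaries ground_gr (C_mod T) 0 q"
      if "b \<in> coboundaries ground_gr (Cpart T) 0 q" for b
      unfolding C_mod_def by (rule mod2.coboundaries_base_change[OF c(1) that])
    show "map_vec of_int (b + v) = (map_vec of_int b + map_vec of_int v :: bit vec)"
      if "b \<in> coboundaries ground_gr (Cpart T) 0 q" for b
      by (rule mod2.map_vec_add[OF subsetD[OF S that] vc])
  qed (use vc in simp)
qed

lemma p_map_class:
  assumes T: "leo_triple r T" and v: "v \<in> cocycles poly_gr (Dpart T) 0 q"
  shows "p_map r T q (coh_class poly_gr (Dpart T) 0 q v) = coh_class ground_gr (D_mod r T) 0 q (map_vec (red_S r) v)"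
proof -
  note c = leo_triple_cplx[OF T] and vc = cocycles_carrier[OF v]
  note S = subgroup.subset[OF poly.subgroup_coboundaries[OF c(2), of 0 q], unfolded monoid_vec_simps]
  show ?thesis
    unfolding p_map_def
  proof (rule ground.coh_map_class[OF c(4) _ _ poly.coboundaries_zero[OF c(2)] vc])
    show "map_vec (red_S r) b \<in> coboundaries ground_gr (D_mod r T) 0 q"
      if "b \<in> coboundaries poly_gr (Dpart T) 0 q" for b
      unfolding D_mod_def by (rule red.coboundaries_base_change[OF c(2) that])
    show "map_vec (red_S r) (b + v) = map_vec (red_S r) b + map_vec (red_S r) v"
      if "b \<in> coboundaries poly_gr (Dpart T) 0 q" for b
      by (rule red.map_vec_add[OF subsetD[OF S that] vc])
  qed (use vc in simp)
qed

lemma i_map_class: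
  assumes T: "leo_triple r T" and v: "v \<in> cocycles poly_gr (Dpart T) 0 q"
  shows "i_map T q (coh_class poly_gr (Dpart T) 0 q v) = coh_class laurent_gr (D_loc T) 0 q (map_vec to_laurent v)"
proof -
  note c = leo_triple_cplx[OF T] and vc = cocycles_carrier[OF v]
  note S = subgroup.subset[OF poly.subgroup_coboundaries[OF c(2), of 0 q], unfolded monoid_vec_simps]
  show ?thesis
    unfolding i_map_def
  proof (rule laurent.coh_map_class[OF c(5) _ _ poly.coboundaries_zero[OF c(2)] vc])
    show "map_vec to_laurent b \<in> coboundaries laurent_gr (D_loc T) 0 q"
      if "b \<in> coboundaries poly_gr (Dpart T) 0 q" for b
      unfolding D_loc_def by (rule loc.coboundaries_base_change[OF c(2) that])
    show "map_vec to_laurent (b + v) = map_vec to_laurent b + map_vec to_laurent v"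
      if "b \<in> coboundaries poly_gr (Dpart T) 0 q" for b
      by (rule loc.map_vec_add[OF subsetD[OF S that] vc])
  qed (use vc in simp)
qed

lemma f_map_class:
  assumes T: "leo_triple r T" and v: "v \<in> cocycles ground_gr (C_mod T) 0 q"
  shows "f_map r T q (coh_class ground_gr (C_mod T) 0 q v) = coh_class ground_gr (D_mod r T) 0 q (fpart T *\<^sub>v v)"
proof -
  note c = leo_triple_cplx[OF T] and vc = cocycles_carrier[OF v]
  note S = subgroup.subset[OF ground.subgroup_coboundaries[OF c(3), of 0 q], unfolded monoid_vec_simps]
  show ?thesis
    unfolding f_map_def
  proof (rule ground.coh_map_class[OF c(4) _ _ ground.coboundaries_zero[OF c(3)] vc])
    show "fpart T *\<^sub>v b \<in> coboundaries ground_gr (D_mod r T) 0 q"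
      if "b \<in> coboundaries ground_gr (C_mod T) 0 q" for b
      by (rule ground.chain_map_coboundary[OF c(3,4,6) that])
    show "fpart T *\<^sub>v (b + v) = fpart T *\<^sub>v b + fpart T *\<^sub>v v"
      if "b \<in> coboundaries ground_gr (C_mod T) 0 q" for b
      by (rule mult_add_distrib_mat_vec[OF chain_map_carrier[OF c(6)] subsetD[OF S that] vc])
  qed (rule mult_mat_vec_carrier[OF chain_map_carrier[OF c(6)] vc])
qed

text \<open>The components of a local map from a shifted unit are read as cocycles, and its homotopy condition
as a coboundary.\<close>

lemma locally_full_iff_cocycles:
  assumes T: "leo_triple r T"
  shows "locally_full r T q \<longleftrightarrow> even q \<and>
    (\<exists>x\<in>cocycles ground_gr (Cpart T) 0 q. \<exists>a\<in>cocycles poly_gr (Dpart T) 0 q.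
      homotopy_equiv laurent_gr (rank_one (0, q)) (D_loc T) (col_mat (map_vec to_laurent a)) \<and>
      fpart T *\<^sub>v map_vec of_int x - map_vec (red_S r) a \<in> coboundaries ground_gr (D_mod r T) 0 q)"
proof -
  note c = leo_triple_cplx[OF T]
  note f = chain_map_carrier[OF c(6), unfolded rank_mod_loc]
  have lm: "local_map r (shifted_unit q) T (col_mat x) (col_mat a) \<longleftrightarrow>
      x \<in> cocycles ground_gr (Cpart T) 0 q \<and> a \<in> cocycles poly_gr (Dpart T) 0 q \<and>
      homotopy_equiv laurent_gr (rank_one (0, q)) (D_loc T) (col_mat (map_vec to_laurent a)) \<and>
      fpart T *\<^sub>v map_vec of_int x - map_vec (red_S r) a \<in> coboundaries ground_gr (D_mod r T) 0 q" for x a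
  proof (cases "x \<in> cocycles ground_gr (Cpart T) 0 q \<and> a \<in> cocycles poly_gr (Dpart T) 0 q")
    case True
    then have xa: "x \<in> carrier_vec (rank (Cpart T))" "a \<in> carrier_vec (rank (Dpart T))"
      using cocycles_carrier by blast+
    have mx: "map_vec of_int x \<in> carrier_vec (rank (Cpart T))" and ma: "map_vec (red_S r) a \<in> carrier_vec (rank (Dpart T))"
      using xa by simp_all
    have "fpart T * map_mat of_int (col_mat x) = col_mat (fpart T *\<^sub>v map_vec of_int x)"
      unfolding map_col_mat by (rule mult_col_mat[OF f mx])
    moreover have "map_mat (red_S r) (col_mat a) * 1\<^sub>m 1 = col_mat (map_vec (red_S r) a)"
      unfolding map_col_mat by (rule right_mult_one_mat[OF col_mat_carrier[OF ma]])
    moreover have "fpart T *\<^sub>v map_vec of_int x \<in> carrier_vec (rank (Dpart T))"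
      by (rule mult_mat_vec_carrier[OF f mx])
    ultimately show ?thesis
      unfolding local_map_def shifted_unit_simps chain_map_rank_one_iff[OF c(1)] chain_map_rank_one_iff[OF c(2)]
      using ma True by (simp add: homotopic_rank_one_iff[OF c(4)] map_col_mat)
  next
    case False
    then show ?thesis
      unfolding local_map_def shifted_unit_simps chain_map_rank_one_iff[OF c(1)] chain_map_rank_one_iff[OF c(2)]
      by blast
  qed
  have "\<exists>x a. \<alpha> = col_mat x \<and> \<beta> = col_mat a" if "local_map r (shifted_unit q) T \<alpha> \<beta>" for \<alpha> \<beta>
  proof -
    have "chain_map ground_gr (rank_one (0, q)) (Cpart T) \<alpha>" "chain_map poly_gr (rank_one (0, q)) (Dpart T) \<beta>"
      using that unfolding local_map_def shifted_unit_simps by blast+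
    then have \<alpha>: "\<alpha> \<in> carrier_mat (rank (Cpart T)) 1" and \<beta>: "\<beta> \<in> carrier_mat (rank (Dpart T)) 1"
      using chain_map_carrier by fastforce+
    have "\<alpha> = col_mat (col \<alpha> 0)" "\<beta> = col_mat (col \<beta> 0)"
      by (rule one_column_mat[OF \<alpha>], rule one_column_mat[OF \<beta>])
    then show ?thesis by (intro exI conjI)
  qed
  then have "(\<exists>\<alpha> \<beta>. local_map r (shifted_unit q) T \<alpha> \<beta>) \<longleftrightarrow>
      (\<exists>x a. local_map r (shifted_unit q) T (col_mat x) (col_mat a))" by blast
  then show ?thesis unfolding locally_full_def lm by blast
qed

text \<open>The predicate \<open>Q\<close> stands for the condition on the localized class, the only part in which complete
and odd fullness differ.\<close>

lemma locally_full_iff_classes: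
  assumes T: "leo_triple r T"
    and Q: "\<And>v. even q \<Longrightarrow> v \<in> cocycles laurent_gr (D_loc T) 0 q \<Longrightarrow>
      Q (coh_class laurent_gr (D_loc T) 0 q v) \<longleftrightarrow> homotopy_equiv laurent_gr (rank_one (0, q)) (D_loc T) (col_mat v)"
  shows "even q \<and> (\<exists>x\<in>carrier (coh_C T q). \<exists>a\<in>carrier (coh_D T q).
      f_map r T q (j_map T q x) = p_map r T q a \<and> Q (i_map T q a)) \<longleftrightarrow> locally_full r T q"
proof -
  note c = leo_triple_cplx[OF T]
  have "f_map r T q (j_map T q (coh_class ground_gr (Cpart T) 0 q x)) = p_map r T q (coh_class poly_gr (Dpart T) 0 q a) \<and>
      Q (i_map T q (coh_class poly_gr (Dpart T) 0 q a)) \<longleftrightarrow>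
      homotopy_equiv laurent_gr (rank_one (0, q)) (D_loc T) (col_mat (map_vec to_laurent a)) \<and>
      fpart T *\<^sub>v map_vec of_int x - map_vec (red_S r) a \<in> coboundaries ground_gr (D_mod r T) 0 q"
    if q: "even q" and x: "x \<in> cocycles ground_gr (Cpart T) 0 q" and a: "a \<in> cocycles poly_gr (Dpart T) 0 q" for x a
  proof -
    have mx: "map_vec of_int x \<in> cocycles ground_gr (C_mod T) 0 q"
      unfolding C_mod_def by (rule mod2.cocycles_base_change[OF c(1) x])
    have ma: "map_vec (red_S r) a \<in> cocycles ground_gr (D_mod r T) 0 q"
      unfolding D_mod_def by (rule red.cocycles_base_change[OF c(2) a])
    have la: "map_vec to_laurent a \<in> cocycles laurent_gr (D_loc T) 0 q"
      unfolding D_loc_def by (rule loc.cocycles_base_change[OF c(2) a])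
    have fx: "fpart T *\<^sub>v map_vec of_int x \<in> cocycles ground_gr (D_mod r T) 0 q"
      by (rule ground.chain_map_cocycle[OF c(3,4,6) mx])
    show ?thesis
      unfolding j_map_class[OF T x] f_map_class[OF T mx] p_map_class[OF T a] i_map_class[OF T a]
        ground.coh_class_eq_iff[OF c(4) cocycles_carrier[OF fx] cocycles_carrier[OF ma]] Q[OF q la]
      by blast
  qed
  then show ?thesis
    unfolding locally_full_iff_cocycles[OF T] coh_C_def coh_D_def ground.carrier_cohomology poly.carrier_cohomology
    by blast
qed

end

interpretation int_red: reduction mod2_int
  by unfold_locales

interpretation bit_red: reduction mod2_bit
  by unfold_locales simp_all

text \<open>In terms of the coordinate \<open>\<chi>\<close>, the class of \<open>v\<close> generates the localized cohomology if and only if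
every integer is a multiple of \<open>\<chi> v\<close>, that is, if and only if \<open>\<chi> v\<close> is a unit.\<close>

lemma completely_reduced_full_eq:
  assumes T: "leo_triple mod2_int T"
  shows "completely_reduced_full T = locally_full mod2_int T"
proof
  fix q
  have X: "is_cplx laurent_gr (D_loc T)" by (rule int_red.leo_triple_cplx(5)[OF T])
  let ?H = "coh_D_loc T q" and ?cl = "coh_class laurent_gr (D_loc T) 0 q"
  let ?Z = "cocycles laurent_gr (D_loc T) 0 q" and ?B = "coboundaries laurent_gr (D_loc T) 0 q"
  interpret H: group ?H unfolding coh_D_loc_def by (rule laurent.group_cohomology[OF X])
  note cl_mult = laurent.mult_coh_class[OF X, of _ 0 q, folded coh_D_loc_def]
    and cl_one = laurent.one_cohomology[OF X, of 0 q, folded coh_D_loc_def]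
    and cl_inv = laurent.inv_coh_class[OF X, of _ 0 q, folded coh_D_loc_def]
    and Z_add = laurent.cocycles_add[OF X, of _ 0 q] and Z_uminus = laurent.cocycles_uminus[OF X, of _ 0 q]
    and Z_zero = laurent.cocycles_zero[OF X, of 0 q] and Zc = cocycles_carrier[of _ laurent_gr "D_loc T" 0 q]
  have car: "carrier ?H = ?cl ` ?Z" unfolding coh_D_loc_def by (rule laurent.carrier_cohomology)
  have "generate ?H {?cl v} = carrier ?H \<longleftrightarrow>
      homotopy_equiv laurent_gr (rank_one (0, q)) (D_loc T) (col_mat v)"
    if q: "even q" and v: "v \<in> ?Z" for v
  proof -
    obtain \<chi> :: "int laurent vec \<Rightarrow> int" and e where e: "e \<in> ?Z" "\<chi> e = 1"
      and \<chi>_add: "\<And>v w. v \<in> ?Z \<Longrightarrow> w \<in> ?Z \<Longrightarrow> \<chi> (v + w) = \<chi> v + \<chi> w"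
      and \<chi>_0: "\<And>v. v \<in> ?Z \<Longrightarrow> \<chi> v = 0 \<longleftrightarrow> v \<in> ?B"
      and \<chi>_unit: "\<And>v. v \<in> ?Z \<Longrightarrow>
        \<chi> v dvd 1 \<longleftrightarrow> homotopy_equiv laurent_gr (rank_one (0, q)) (D_loc T) (col_mat v)"
      by (rule int_red.localized_class_coordinate[OF T q]) blast
    have "0\<^sub>v (rank (D_loc T)) \<in> ?B" by (rule laurent.coboundaries_zero[OF X])
    then have \<chi>_zero: "\<chi> (0\<^sub>v (rank (D_loc T))) = 0" using \<chi>_0[OF Z_zero] by simp
    have \<chi>_uminus: "\<chi> (- w) = - \<chi> w" if w: "w \<in> ?Z" for w
    proof -
      have "w + - w = 0\<^sub>v (rank (D_loc T))" using Zc[OF w] by (intro eq_vecI) simp_all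
      then show ?thesis using \<chi>_add[OF w Z_uminus[OF w]] \<chi>_zero by simp
    qed
    have minus: "w - u = w + - u" if "w \<in> ?Z" "u \<in> ?Z" for w u
      using Zc[OF that(1)] Zc[OF that(2)] by (intro eq_vecI) simp_all
    have class_eq: "?cl w = ?cl u \<longleftrightarrow> \<chi> w = \<chi> u" if "w \<in> ?Z" "u \<in> ?Z" for w u
      unfolding laurent.coh_class_eq_iff[OF X Zc[OF that(1)] Zc[OF that(2)]]
      using \<chi>_0[OF Z_add[OF that(1) Z_uminus[OF that(2)]]] minus[OF that] \<chi>_add[OF that(1) Z_uminus[OF that(2)]]
        \<chi>_uminus[OF that(2)] by simp
    have "generate ?H {?cl v} = carrier ?H \<longleftrightarrow> \<chi> v dvd 1"
    proof
      assume gen: "generate ?H {?cl v} = carrier ?H"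
      \<comment> \<open>All coordinates in the generated subgroup are multiples of \<open>\<chi> v\<close>.\<close>
      have "\<exists>w\<in>?Z. A = ?cl w \<and> \<chi> v dvd \<chi> w" if "A \<in> generate ?H {?cl v}" for A
        using that
      proof (induction rule: generate.induct)
        case one
        show ?case using Z_zero \<chi>_zero by (auto simp: cl_one intro!: bexI[OF _ Z_zero])
      next
        case (incl A)
        then show ?case using v by auto
      next
        case (inv A)
        then show ?case using v Z_uminus[OF v] by (auto simp: cl_inv[OF v] \<chi>_uminus[OF v] intro!: bexI[of _ "- v"])
      next
        case (eng A A')
        then obtain w w' where w: "w \<in> ?Z" "A = ?cl w" "\<chi> v dvd \<chi> w" and w': "w' \<in> ?Z" "A' = ?cl w'" "\<chi> v dvd \<chi> w'"
          by blast
        then show ?case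
          by (intro bexI[of _ "w + w'"]) (simp_all add: cl_mult \<chi>_add Z_add)
      qed
      moreover have "?cl e \<in> generate ?H {?cl v}" unfolding gen car using e(1) by blast
      ultimately obtain w where "w \<in> ?Z" "?cl e = ?cl w" "\<chi> v dvd \<chi> w" by blast
      then show "\<chi> v dvd 1" using class_eq[OF e(1)] e(2) by metis
    next
      assume "\<chi> v dvd 1"
      then obtain c where c: "1 = \<chi> v * c" by (elim dvdE)
      have vH: "?cl v \<in> carrier ?H" unfolding car using v by blast
      \<comment> \<open>Adding or subtracting \<open>v\<close> reduces to coordinate 0, where the class is zero.\<close>
      have gen: "?cl w \<in> generate ?H {?cl v}" if "w \<in> ?Z" "\<chi> w = n * \<chi> v" for n w
        using that
      proof (induction n arbitrary: w rule: int_induct[where k = 0])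
        case base
        then have "?cl w = \<one>\<^bsub>?H\<^esub>" unfolding cl_one using class_eq[OF base(1) Z_zero] \<chi>_zero by simp
        then show ?case using generate.one[of ?H] by simp
      next
        case (step1 n)
        have "?cl (w + - v) \<in> generate ?H {?cl v}"
          by (rule step1.IH) (use step1.prems v in \<open>simp_all add: \<chi>_add Z_uminus \<chi>_uminus Z_add algebra_simps\<close>)
        then have "?cl (w + - v) \<otimes>\<^bsub>?H\<^esub> ?cl v \<in> generate ?H {?cl v}"
          by (rule generate.eng[OF _ generate.incl]) simp
        moreover have "w + - v + v = w" using Zc[OF v] Zc[OF step1.prems(1)] by (intro eq_vecI) simp_all
        ultimately show ?case using cl_mult[OF Z_add[OF step1.prems(1) Z_uminus[OF v]] v] by simp
      next
        case (step2 n)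
        have "?cl (w + v) \<in> generate ?H {?cl v}"
          by (rule step2.IH) (use step2.prems v in \<open>simp_all add: \<chi>_add Z_add algebra_simps\<close>)
        moreover have "?cl (- v) \<in> generate ?H {?cl v}"
          using generate.inv[of "?cl v" "{?cl v}" ?H] by (simp add: cl_inv[OF v])
        ultimately have "?cl (w + v) \<otimes>\<^bsub>?H\<^esub> ?cl (- v) \<in> generate ?H {?cl v}"
          by (rule generate.eng)
        moreover have "w + v + - v = w" using Zc[OF v] Zc[OF step2.prems(1)] by (intro eq_vecI) simp_all
        ultimately show ?case using cl_mult[OF Z_add[OF step2.prems(1) v] Z_uminus[OF v]] by simp
      qed
      have "carrier ?H \<subseteq> generate ?H {?cl v}"
      proof
        fix A assume "A \<in> carrier ?H"
        then obtain w where w: "w \<in> ?Z" "A = ?cl w" unfolding car by blast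
        have "\<chi> w = (\<chi> w * c) * \<chi> v" using c by (simp add: algebra_simps)
        then show "A \<in> generate ?H {?cl v}" unfolding w(2) by (rule gen[OF w(1)])
      qed
      moreover have "generate ?H {?cl v} \<subseteq> carrier ?H"
        using H.generate_incl[of "{?cl v}"] vH by simp
      ultimately show "generate ?H {?cl v} = carrier ?H" by blast
    qed
    then show ?thesis using \<chi>_unit[OF v] by simp
  qed
  then show "completely_reduced_full T q = locally_full mod2_int T q"
    unfolding completely_reduced_full_def by (rule int_red.locally_full_iff_classes[OF T])
qed

text \<open>In the field with two elements the coordinate of a class is a unit if and only if it is nonzero,
that is, if and only if the class is nonzero.\<close>

lemma oddly_reduced_full_eq:
  assumes T: "leo_triple mod2_bit T"
  shows "oddly_reduced_full T = locally_full mod2_bit T"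
proof
  fix q
  have X: "is_cplx laurent_gr (D_loc T)" by (rule bit_red.leo_triple_cplx(5)[OF T])
  let ?cl = "coh_class laurent_gr (D_loc T) 0 q"
  let ?Z = "cocycles laurent_gr (D_loc T) 0 q" and ?B = "coboundaries laurent_gr (D_loc T) 0 q"
  have "?cl v \<noteq> \<one>\<^bsub>coh_D_loc T q\<^esub> \<longleftrightarrow>
      homotopy_equiv laurent_gr (rank_one (0, q)) (D_loc T) (col_mat v)"
    if q: "even q" and v: "v \<in> ?Z" for v
  proof -
    obtain \<chi> :: "bit laurent vec \<Rightarrow> bit"
      where \<chi>_0: "\<chi> v = 0 \<longleftrightarrow> v \<in> ?B"
      and \<chi>_unit: "\<chi> v dvd 1 \<longleftrightarrow> homotopy_equiv laurent_gr (rank_one (0, q)) (D_loc T) (col_mat v)"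
      by (rule bit_red.localized_class_coordinate[OF T q]) (use v in blast)
    have vc: "v \<in> carrier_vec (rank (D_loc T))" by (rule cocycles_carrier[OF v])
    have "v - 0\<^sub>v (rank (D_loc T)) = v" using vc by (intro eq_vecI) simp_all
    then have "?cl v = \<one>\<^bsub>coh_D_loc T q\<^esub> \<longleftrightarrow> v \<in> ?B"
      unfolding coh_D_loc_def laurent.one_cohomology[OF X]
        laurent.coh_class_eq_iff[OF X vc zero_carrier_vec] by simp
    moreover have "\<chi> v \<noteq> 0 \<longleftrightarrow> \<chi> v dvd 1" by (cases "\<chi> v") simp_all
    ultimately show ?thesis using \<chi>_0 \<chi>_unit by blast
  qed
  then show "oddly_reduced_full T q = locally_full mod2_bit T q"
    unfolding oddly_reduced_full_def by (rule bit_red.locally_full_iff_classes[OF T])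
qed

theorem theorem5p1:
  shows "(\<forall>(T :: int leo) g.
            leo_triple mod2_int T \<and> leo_homotopy_inverse mod2_int T g \<longrightarrow>
            (trivial_triple mod2_int T \<longleftrightarrow> s_c T = 0 \<and> s_c (dual_triple T g) = 0)) \<and>
         (\<forall>(T :: bit leo) g.
            leo_triple mod2_bit T \<and> leo_homotopy_inverse mod2_bit T g \<longrightarrow>
            (trivial_triple mod2_bit T \<longleftrightarrow> s_o T = 0 \<and> s_o (dual_triple T g) = 0))"
proof (intro conjI allI impI; elim conjE)
  fix T :: "int leo" and g
  assume T: "leo_triple mod2_int T" and g: "leo_homotopy_inverse mod2_int T g"
  show "trivial_triple mod2_int T \<longleftrightarrow> s_c T = 0 \<and> s_c (dual_triple T g) = 0"
    unfolding s_c_def completely_reduced_full_eq[OF T] completely_reduced_full_eq[OF int_red.leo_triple_dual[OF T g]]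
    by (rule int_red.trivial_triple_iff[OF T g])
next
  fix T :: "bit leo" and g
  assume T: "leo_triple mod2_bit T" and g: "leo_homotopy_inverse mod2_bit T g"
  show "trivial_triple mod2_bit T \<longleftrightarrow> s_o T = 0 \<and> s_o (dual_triple T g) = 0"
    unfolding s_o_def oddly_reduced_full_eq[OF T] oddly_reduced_full_eq[OF bit_red.leo_triple_dual[OF T g]]
    by (rule bit_red.trivial_triple_iff[OF T g])
qed

end
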